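(* Let $G_\mu$ be a group of $\mu$-good symmetries of $(Q,L_d)$, $\mu\in\mathfrak g^*$. Given $(\delta\tau_0,\delta\tau_1)\in T_{(\tau_0,\tau_1)}\big((Q/G_\mu)\times(Q/G_\mu)\big)$, $$\breve f_\mu(\tau_0,\tau_1)(\delta\tau_0,\delta\tau_1)=\big\langle\mu,\;T_{(q_0,q_1)}\mathcal A_\mu\big(h_\mu^{q_0}(\delta\tau_0),h_\mu^{q_1}(\delta\tau_1)\big)\big\rangle,$$ where $q_0\in Q$ is such that $\pi_\mu(q_0)=\tau_0$ and $q_1:=\overline{h^{q_0}_{d,\mu}}(\tau_1)$.
   Context: For a smooth $H$ on a product manifold, $D_iH$ denotes the partial tangent map in the $i$-th factor. $Q$ is a smooth manifold and $L_d:Q\times Q\to\mathbb R$ a smooth discrete Lagrangian that is regular: $\mathbb F^+L_d(q_0,q_1)=(q_1,D_2L_d(q_0,q_1))$ and $\mathbb F^-L_d(q_0,q_1)=(q_0,-D_1L_d(q_0,q_1))$ are local diffeomorphisms $Q\times Q\to T^*Q$. A Lie group $G$ with Lie algebra $\mathfrak g$ acts on $Q$ freely and properly by a left action $l^Q$, and $L_d$ is invariant under the diagonal action. $\xi_Q$ is the infinitesimal generator of $\xi$. For $\mu\in\mathfrak g^*$, $G_\mu=\{g\in G:\mathrm{Ad}^*_{g^{-1}}\mu=\mu\}$ with Lie algebra $\mathfrak g_\mu=T_eG_\mu$; $\pi_\mu:Q\to Q/G_\mu$ is the quotient principal bundle; $\mu$ also denotes its restriction to $\mathfrak g_\mu$.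 The momentum map $J_\mu:Q\times Q\to\mathfrak g_\mu^*$ is $J_\mu(q_0,q_1)\xi=-D_1L_d(q_0,q_1)\xi_Q(q_0)=D_2L_d(q_0,q_1)\xi_Q(q_1)$. $G_\mu$ is a group of $\mu$-good symmetries if $L_d$ is regular, for all $(q_0,q_1)$ the restriction of the bilinear form $D_2D_1L_d(q_0,q_1):T_{q_0}Q\times T_{q_1}Q\to\mathbb R$ to $T_{q_0}(G_\mu\cdot q_0)\times T_{q_1}(G_\mu\cdot q_1)$ is nondegenerate, and for each $q\in Q$ there is a unique $g\in G_\mu$ with $J_\mu(q,l^Q_g(q))=\mu$. Standing assumption: for all $(q_0,q_1)\in Q\times Q$ there is a unique $g\in G_\mu$ with $J_\mu(q_0,l^Q_{g^{-1}}(q_1))=\mu$, and the map $\mathcal A_\mu:Q\times Q\to G_\mu$, $\mathcal A_\mu(q_0,q_1):=g$, is smooth (the affine discrete connection associated to $J_\mu$). Then $\mathcal A_\mu(l^Q_{g_0}q_0,l^Q_{g_1}q_1)=g_1\mathcal A_\mu(q_0,q_1)g_0^{-1}$ and $\mathcal A_\mu(q_0,q_1)=e\iff J_\mu(q_0,q_1)=\mu$. For $q_0\in Q$, $\tau_1\in Q/G_\mu$, $\overline{h^{q_0}_{d,\mu}}(\tau_1)$ is the unique $q_1\in Q$ with $\pi_\mu(q_1)=\tau_1$ and $J_\mu(q_0,q_1)=\mu$. A principal connection $\mathfrak A:TQ\to\mathfrak g_\mu$ on $\pi_\mu$ is fixed, with horizontal lift $h_\mu^q:T_{\pi_\mu(q)}(Q/G_\mu)\to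 T_qQ$. Define $\check L_\mu:Q\times G_\mu\times(Q/G_\mu)\to\mathbb R$, $\check L_\mu(q_0,w,\tau_1):=L_d\big(q_0,l^Q_w(\overline{h^{q_0}_{d,\mu}}(\tau_1))\big)$, and the 1-form $\breve f_\mu$ on $(Q/G_\mu)\times(Q/G_\mu)$ by $$\breve f_\mu(\tau_0,\tau_1)(\delta\tau_0,\delta\tau_1):=D_2\check L_\mu(q_0,e,\tau_1)\big(T_{(q_0,q_1)}\mathcal A_\mu(h_\mu^{q_0}(\delta\tau_0),h_\mu^{q_1}(\delta\tau_1))\big)$$ with $q_0\in\pi_\mu^{-1}(\tau_0)$ and $q_1=\overline{h^{q_0}_{d,\mu}}(\tau_1)$. *)

theory Defs
  imports "HOL-Analysis.Analysis" "HOL-Algebra.Group"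
begin

section \<open>Smooth manifolds\<close>

text \<open>
  Model spaces are normed spaces that \<open>smooth_manifold\<close> requires to be finite-dimensional. Class
  \<open>euclidean_space\<close> is avoided because it excludes dimension 0, which does occur for Lie groups
  and for quotients.
\<close>

fun Ck_on :: "nat \<Rightarrow> 'a::real_normed_vector set \<Rightarrow> ('a \<Rightarrow> 'b::real_normed_vector) \<Rightarrow> bool" where
  "Ck_on 0 S f \<longleftrightarrow> continuous_on S f"
| "Ck_on (Suc n) S f \<longleftrightarrow> (\<forall>x\<in>S. f differentiable (at x)) \<and>
     (\<forall>v. Ck_on n S (\<lambda>x. frechet_derivative f (at x) v))"

text \<open>Used only for open \<open>S\<close>.\<close>

definition smooth_on :: "'a::real_normed_vector set \<Rightarrow> ('a \<Rightarrow> 'b::real_normed_vector) \<Rightarrow> bool" where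
  "smooth_on S f \<longleftrightarrow> (\<forall>n. Ck_on n S f)"

text \<open>
  A chart is a domain with a coordinate map whose values off the domain are irrelevant. A manifold is
  given by a (not necessarily maximal) atlas, which determines its point set and its topology.
\<close>

type_synonym ('a, 'm) chart = "'a set \<times> ('a \<Rightarrow> 'm)"
type_synonym ('a, 'm) atlas = "('a, 'm) chart set"

definition mcarrier :: "('a, 'm) atlas \<Rightarrow> 'a set" where
  "mcarrier M = \<Union>(fst ` M)"

definition mtop :: "('a, 'm::real_normed_vector) atlas \<Rightarrow> 'a topology" where
  "mtop M = topology_generated_by {{p \<in> U. \<phi> p \<in> S} | U \<phi> S. (U, \<phi>) \<in> M \<and> open S}"

definition charts_at :: "('a, 'm) atlas \<Rightarrow> 'a \<Rightarrow> ('a, 'm) chart set" where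
  "charts_at M p = {c \<in> M. p \<in> fst c}"

definition chart_inv :: "('a, 'm) chart \<Rightarrow> 'm \<Rightarrow> 'a" where
  "chart_inv c = inv_into (fst c) (snd c)"

definition smooth_manifold :: "('a, 'm::real_normed_vector) atlas \<Rightarrow> bool" where
  "smooth_manifold M \<longleftrightarrow>
     (\<exists>B::'m set. finite B \<and> span B = UNIV) \<and>
     (\<forall>c\<in>M. inj_on (snd c) (fst c) \<and> open (snd c ` fst c)) \<and>
     (\<forall>c\<in>M. \<forall>d\<in>M. open (snd c ` (fst c \<inter> fst d)) \<and>
        smooth_on (snd c ` (fst c \<inter> fst d)) (snd d \<circ> chart_inv c)) \<and>
     Hausdorff_space (mtop M) \<and> second_countable (mtop M)"

definition smooth_map ::
  "('a, 'm::real_normed_vector) atlas \<Rightarrow> ('b, 'n::real_normed_vector) atlas \<Rightarrow> ('a \<Rightarrow> 'b) \<Rightarrow> bool" where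
  "smooth_map M N F \<longleftrightarrow> F ` mcarrier M \<subseteq> mcarrier N \<and>
     (\<forall>p\<in>mcarrier M. \<forall>c\<in>charts_at M p. \<forall>d\<in>charts_at N (F p).
        \<exists>W. open W \<and> snd c p \<in> W \<and> W \<subseteq> snd c ` fst c \<and> F ` chart_inv c ` W \<subseteq> fst d \<and>
            smooth_on W (snd d \<circ> F \<circ> chart_inv c))"

definition diffeo ::
  "('a, 'm::real_normed_vector) atlas \<Rightarrow> ('b, 'n::real_normed_vector) atlas \<Rightarrow> ('a \<Rightarrow> 'b) \<Rightarrow> bool" where
  "diffeo M N F \<longleftrightarrow> bij_betw F (mcarrier M) (mcarrier N) \<and> smooth_map M N F \<and>
     smooth_map N M (inv_into (mcarrier M) F)"

definition restrict_manifold :: "('a, 'm) atlas \<Rightarrow> 'a set \<Rightarrow> ('a, 'm) atlas" where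
  "restrict_manifold M W = (\<lambda>c. (fst c \<inter> W, snd c)) ` M"

definition local_diffeo ::
  "('a, 'm::real_normed_vector) atlas \<Rightarrow> ('b, 'n::real_normed_vector) atlas \<Rightarrow> ('a \<Rightarrow> 'b) \<Rightarrow> bool" where
  "local_diffeo M N F \<longleftrightarrow> (\<forall>p\<in>mcarrier M. \<exists>W V. openin (mtop M) W \<and> p \<in> W \<and> openin (mtop N) V \<and>
     diffeo (restrict_manifold M W) (restrict_manifold N V) F)"

definition prod_manifold :: "('a, 'm) atlas \<Rightarrow> ('b, 'n) atlas \<Rightarrow> ('a \<times> 'b, 'm \<times> 'n) atlas" where
  "prod_manifold M N = {(fst c \<times> fst d, map_prod (snd c) (snd d)) | c d. c \<in> M \<and> d \<in> N}"

definition vspace_manifold :: "('v, 'v) atlas" where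
  "vspace_manifold = {(UNIV, \<lambda>x. x)}"


section \<open>Tangent and cotangent vectors\<close>

text \<open>
  A tangent vector at \<open>p\<close> is a family of coordinate vectors, one for each chart at \<open>p\<close>, that
  transforms with the derivatives of the chart changes (and is 0 on all other charts). The vector
  space structure is pointwise. The base point is not part of the vector.
\<close>

type_synonym ('a, 'm) tvec = "('a, 'm) chart \<Rightarrow> 'm"

definition tspace :: "('a, 'm::real_normed_vector) atlas \<Rightarrow> 'a \<Rightarrow> ('a, 'm) tvec set" where
  "tspace M p = {X.
     (\<forall>c\<in>charts_at M p. \<forall>d\<in>charts_at M p.
        X d = frechet_derivative (snd d \<circ> chart_inv c) (at (snd c p)) (X c)) \<and>
     (\<forall>c. c \<notin> charts_at M p \<longrightarrow> X c = 0)}"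

definition tzero :: "('a, 'm::real_normed_vector) tvec" where
  "tzero = (\<lambda>c. 0)"

definition tadd :: "('a, 'm::real_normed_vector) tvec \<Rightarrow> ('a, 'm) tvec \<Rightarrow> ('a, 'm) tvec" where
  "tadd X Y = (\<lambda>c. X c + Y c)"

definition tscale :: "real \<Rightarrow> ('a, 'm::real_normed_vector) tvec \<Rightarrow> ('a, 'm) tvec" where
  "tscale r X = (\<lambda>c. r *\<^sub>R X c)"

text \<open>The tangent vector at \<open>p\<close> with coordinates \<open>v\<close> in the chart \<open>c\<close>.\<close>

definition tvec_of ::
  "('a, 'm::real_normed_vector) atlas \<Rightarrow> ('a, 'm) chart \<Rightarrow> 'a \<Rightarrow> 'm \<Rightarrow> ('a, 'm) tvec" where
  "tvec_of M c p v = (\<lambda>d. if d \<in> charts_at M p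
     then frechet_derivative (snd d \<circ> chart_inv c) (at (snd c p)) v else 0)"

text \<open>
  \<open>tmap M N F p\<close> is the tangent map of \<open>F\<close> at \<open>p\<close>. For a function with values in a normed space,
  \<open>mdiff M f p\<close> is its differential, with the tangent spaces of the target identified with the
  target. The chart used at \<open>p\<close> is immaterial on \<open>tspace M p\<close>.
\<close>

definition tmap ::
  "('a, 'm::real_normed_vector) atlas \<Rightarrow> ('b, 'n::real_normed_vector) atlas \<Rightarrow> ('a \<Rightarrow> 'b) \<Rightarrow> 'a
    \<Rightarrow> ('a, 'm) tvec \<Rightarrow> ('b, 'n) tvec" where
  "tmap M N F p X = (let c = (SOME c. c \<in> charts_at M p) in
     (\<lambda>d. if d \<in> charts_at N (F p)
       then frechet_derivative (snd d \<circ> F \<circ> chart_inv c) (at (snd c p)) (X c) else 0))"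

definition mdiff ::
  "('a, 'm::real_normed_vector) atlas \<Rightarrow> ('a \<Rightarrow> 'v::real_normed_vector) \<Rightarrow> 'a \<Rightarrow> ('a, 'm) tvec \<Rightarrow> 'v" where
  "mdiff M f p X = (let c = (SOME c. c \<in> charts_at M p) in
     frechet_derivative (f \<circ> chart_inv c) (at (snd c p)) (X c))"

text \<open>The vector corresponding to \<open>(X, Y)\<close> under the identification
  \<open>T\<^sub>(\<^sub>p\<^sub>,\<^sub>q\<^sub>)(M \<times> N) = T\<^sub>pM \<times> T\<^sub>qN\<close> given by the two projections.\<close>

definition tpair ::
  "('a, 'm::real_normed_vector) atlas \<Rightarrow> ('b, 'n::real_normed_vector) atlas \<Rightarrow> 'a \<Rightarrow> 'b
    \<Rightarrow> ('a, 'm) tvec \<Rightarrow> ('b, 'n) tvec \<Rightarrow> ('a \<times> 'b, 'm \<times> 'n) tvec" where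
  "tpair M N p q X Y = (THE Z. Z \<in> tspace (prod_manifold M N) (p, q) \<and>
     tmap (prod_manifold M N) M fst (p, q) Z = X \<and> tmap (prod_manifold M N) N snd (p, q) Z = Y)"

text \<open>Covectors are \<open>undefined\<close> off the tangent space, so that they are equal as soon as
  they agree on it.\<close>

definition ctspace :: "('a, 'm::real_normed_vector) atlas \<Rightarrow> 'a \<Rightarrow> (('a, 'm) tvec \<Rightarrow> real) set" where
  "ctspace M p = {\<alpha> \<in> extensional (tspace M p).
     (\<forall>X\<in>tspace M p. \<forall>Y\<in>tspace M p. \<alpha> (tadd X Y) = \<alpha> X + \<alpha> Y) \<and>
     (\<forall>r. \<forall>X\<in>tspace M p. \<alpha> (tscale r X) = r * \<alpha> X)}"

definition tangent_bundle ::
  "('a, 'm::real_normed_vector) atlas \<Rightarrow> ('a \<times> ('a, 'm) tvec, 'm \<times> 'm) atlas" where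
  "tangent_bundle M =
     (\<lambda>c. ({(p, X). p \<in> fst c \<and> X \<in> tspace M p}, \<lambda>(p, X). (snd c p, X c))) ` M"

definition cotangent_bundle ::
  "('a, 'm::real_normed_vector) atlas \<Rightarrow> ('a \<times> (('a, 'm) tvec \<Rightarrow> real), 'm \<times> ('m \<Rightarrow>\<^sub>L real)) atlas" where
  "cotangent_bundle M =
     (\<lambda>c. ({(p, \<alpha>). p \<in> fst c \<and> \<alpha> \<in> ctspace M p},
           \<lambda>(p, \<alpha>). (snd c p, Blinfun (\<lambda>v. \<alpha> (tvec_of M c p v))))) ` M"

text \<open>The vector space \<open>tspace M p\<close> as a manifold.\<close>

definition tspace_manifold ::
  "('a, 'm::real_normed_vector) atlas \<Rightarrow> 'a \<Rightarrow> (('a, 'm) tvec, 'm) atlas" where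
  "tspace_manifold M p = (\<lambda>c. (tspace M p, \<lambda>X. X c)) ` charts_at M p"

definition embedded_submanifold ::
  "('a, 'n::real_normed_vector) atlas \<Rightarrow> ('a, 'm::real_normed_vector) atlas \<Rightarrow> bool" where
  "embedded_submanifold N M \<longleftrightarrow> smooth_manifold N \<and> mcarrier N \<subseteq> mcarrier M \<and>
     smooth_map N M (\<lambda>x. x) \<and>
     (\<forall>p\<in>mcarrier N. inj_on (tmap N M (\<lambda>x. x) p) (tspace N p)) \<and>
     mtop N = subtopology (mtop M) (mcarrier N)"


section \<open>Lie groups and actions\<close>

text \<open>Throughout, \<open>AG\<close> and \<open>AK\<close> are the atlases of the groups \<open>G\<close> and \<open>K\<close>. The Lie algebra of \<open>G\<close>
  is the tangent space at the identity; the bracket plays no role here.\<close>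

definition lie_group :: "('g, 'z) monoid_scheme \<Rightarrow> ('g, 'k::real_normed_vector) atlas \<Rightarrow> bool" where
  "lie_group G AG \<longleftrightarrow> group G \<and> smooth_manifold AG \<and> mcarrier AG = carrier G \<and>
     smooth_map (prod_manifold AG AG) AG (\<lambda>(g, h). g \<otimes>\<^bsub>G\<^esub> h) \<and> smooth_map AG AG (m_inv G)"

abbreviation lie_algebra ::
  "('g, 'z) monoid_scheme \<Rightarrow> ('g, 'k::real_normed_vector) atlas \<Rightarrow> ('g, 'k) tvec set" where
  "lie_algebra G AG \<equiv> tspace AG \<one>\<^bsub>G\<^esub>"

definition Ad ::
  "('g, 'z) monoid_scheme \<Rightarrow> ('g, 'k::real_normed_vector) atlas \<Rightarrow> 'g \<Rightarrow> ('g, 'k) tvec \<Rightarrow> ('g, 'k) tvec" where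
  "Ad G AG g \<xi> = tmap AG AG (\<lambda>h. g \<otimes>\<^bsub>G\<^esub> h \<otimes>\<^bsub>G\<^esub> inv\<^bsub>G\<^esub> g) \<one>\<^bsub>G\<^esub> \<xi>"

definition Ad_star ::
  "('g, 'z) monoid_scheme \<Rightarrow> ('g, 'k::real_normed_vector) atlas \<Rightarrow> 'g \<Rightarrow> (('g, 'k) tvec \<Rightarrow> real)
    \<Rightarrow> (('g, 'k) tvec \<Rightarrow> real)" where
  "Ad_star G AG g \<mu> = (\<lambda>\<xi>\<in>lie_algebra G AG. \<mu> (Ad G AG g \<xi>))"

definition coadjoint_isotropy ::
  "('g, 'z) monoid_scheme \<Rightarrow> ('g, 'k::real_normed_vector) atlas \<Rightarrow> (('g, 'k) tvec \<Rightarrow> real) \<Rightarrow> 'g set" where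
  "coadjoint_isotropy G AG \<mu> = {g \<in> carrier G. Ad_star G AG (inv\<^bsub>G\<^esub> g) \<mu> = \<mu>}"

definition restrict_dual ::
  "('g, 'z) monoid_scheme \<Rightarrow> ('g, 'k::real_normed_vector) atlas \<Rightarrow> ('g, 'h::real_normed_vector) atlas
    \<Rightarrow> (('g, 'k) tvec \<Rightarrow> real) \<Rightarrow> (('g, 'h) tvec \<Rightarrow> real)" where
  "restrict_dual G AG AK \<mu> = (\<lambda>\<xi>\<in>lie_algebra G AK. \<mu> (tmap AK AG (\<lambda>g. g) \<one>\<^bsub>G\<^esub> \<xi>))"

definition left_action ::
  "('g, 'z) monoid_scheme \<Rightarrow> ('g, 'k::real_normed_vector) atlas \<Rightarrow> ('q, 'm::real_normed_vector) atlas
    \<Rightarrow> ('g \<Rightarrow> 'q \<Rightarrow> 'q) \<Rightarrow> bool" where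
  "left_action G AG Q l \<longleftrightarrow>
     smooth_map (prod_manifold AG Q) Q (\<lambda>(g, q). l g q) \<and>
     (\<forall>q\<in>mcarrier Q. l \<one>\<^bsub>G\<^esub> q = q) \<and>
     (\<forall>g\<in>carrier G. \<forall>h\<in>carrier G. \<forall>q\<in>mcarrier Q. l (g \<otimes>\<^bsub>G\<^esub> h) q = l g (l h q))"

definition free_action ::
  "('g, 'z) monoid_scheme \<Rightarrow> ('q, 'm) atlas \<Rightarrow> ('g \<Rightarrow> 'q \<Rightarrow> 'q) \<Rightarrow> bool" where
  "free_action G Q l \<longleftrightarrow> (\<forall>g\<in>carrier G. \<forall>q\<in>mcarrier Q. l g q = q \<longrightarrow> g = \<one>\<^bsub>G\<^esub>)"

definition proper_action ::
  "('g, 'k::real_normed_vector) atlas \<Rightarrow> ('q, 'm::real_normed_vector) atlas \<Rightarrow> ('g \<Rightarrow> 'q \<Rightarrow> 'q) \<Rightarrow> bool" where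
  "proper_action AG Q l \<longleftrightarrow> proper_map (prod_topology (mtop AG) (mtop Q))
     (prod_topology (mtop Q) (mtop Q)) (\<lambda>(g, q). (l g q, q))"

text \<open>The infinitesimal generator at \<open>q\<close> is the derivative at the identity of the orbit map of \<open>q\<close>.\<close>

definition inf_gen ::
  "('g, 'z) monoid_scheme \<Rightarrow> ('g, 'k::real_normed_vector) atlas \<Rightarrow> ('q, 'm::real_normed_vector) atlas
    \<Rightarrow> ('g \<Rightarrow> 'q \<Rightarrow> 'q) \<Rightarrow> ('g, 'k) tvec \<Rightarrow> 'q \<Rightarrow> ('q, 'm) tvec" where
  "inf_gen G AG Q l \<xi> q = tmap AG Q (\<lambda>g. l g q) \<one>\<^bsub>G\<^esub> \<xi>"

text \<open>As a function of \<open>q\<close>, \<open>orbit K l\<close> is the quotient map.\<close>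

definition orbit :: "('g, 'z) monoid_scheme \<Rightarrow> ('g \<Rightarrow> 'q \<Rightarrow> 'q) \<Rightarrow> 'q \<Rightarrow> 'q set" where
  "orbit K l q = (\<lambda>g. l g q) ` carrier K"

text \<open>The tangent space at \<open>q\<close> of the orbit of \<open>q\<close>, an immersed submanifold through the orbit map.\<close>

definition orbit_tspace ::
  "('g, 'z) monoid_scheme \<Rightarrow> ('g, 'k::real_normed_vector) atlas \<Rightarrow> ('q, 'm::real_normed_vector) atlas
    \<Rightarrow> ('g \<Rightarrow> 'q \<Rightarrow> 'q) \<Rightarrow> 'q \<Rightarrow> ('q, 'm) tvec set" where
  "orbit_tspace K AK Q l q = (\<lambda>\<xi>. inf_gen K AK Q l \<xi> q) ` lie_algebra K AK"

text \<open>
  \<open>B\<close> is a smooth structure on the orbit space for which the quotient map is a principal bundle.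
  Only one such structure exists: \<open>B\<close> is determined up to the choice of an atlas.
\<close>

definition quotient_principal_bundle ::
  "('g, 'z) monoid_scheme \<Rightarrow> ('g, 'k::real_normed_vector) atlas \<Rightarrow> ('q, 'm::real_normed_vector) atlas
    \<Rightarrow> ('g \<Rightarrow> 'q \<Rightarrow> 'q) \<Rightarrow> ('q set, 'b::real_normed_vector) atlas \<Rightarrow> bool" where
  "quotient_principal_bundle K AK Q l B \<longleftrightarrow>
     smooth_manifold B \<and> mcarrier B = orbit K l ` mcarrier Q \<and> smooth_map Q B (orbit K l) \<and>
     (\<forall>\<tau>\<in>mcarrier B. \<exists>U \<Psi>. openin (mtop B) U \<and> \<tau> \<in> U \<and>
        diffeo (prod_manifold (restrict_manifold B U) AK)
          (restrict_manifold Q {q \<in> mcarrier Q. orbit K l q \<in> U}) \<Psi> \<and>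
        (\<forall>\<sigma>\<in>U. \<forall>h\<in>carrier K. orbit K l (\<Psi> (\<sigma>, h)) = \<sigma> \<and>
           (\<forall>g\<in>carrier K. \<Psi> (\<sigma>, g \<otimes>\<^bsub>K\<^esub> h) = l g (\<Psi> (\<sigma>, h)))))"

definition principal_connection ::
  "('g, 'z) monoid_scheme \<Rightarrow> ('g, 'k::real_normed_vector) atlas \<Rightarrow> ('q, 'm::real_normed_vector) atlas
    \<Rightarrow> ('g \<Rightarrow> 'q \<Rightarrow> 'q) \<Rightarrow> ('q \<Rightarrow> ('q, 'm) tvec \<Rightarrow> ('g, 'k) tvec) \<Rightarrow> bool" where
  "principal_connection K AK Q l \<AA> \<longleftrightarrow>
     smooth_map (tangent_bundle Q) (tspace_manifold AK \<one>\<^bsub>K\<^esub>) (\<lambda>(q, X). \<AA> q X) \<and>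
     (\<forall>q\<in>mcarrier Q.
        (\<forall>X\<in>tspace Q q. \<forall>Y\<in>tspace Q q. \<AA> q (tadd X Y) = tadd (\<AA> q X) (\<AA> q Y)) \<and>
        (\<forall>r. \<forall>X\<in>tspace Q q. \<AA> q (tscale r X) = tscale r (\<AA> q X)) \<and>
        (\<forall>\<xi>\<in>lie_algebra K AK. \<AA> q (inf_gen K AK Q l \<xi> q) = \<xi>) \<and>
        (\<forall>g\<in>carrier K. \<forall>X\<in>tspace Q q. \<AA> (l g q) (tmap Q Q (l g) q X) = Ad K AK g (\<AA> q X)))"

definition horizontal_lift ::
  "('g, 'z) monoid_scheme \<Rightarrow> ('q, 'm::real_normed_vector) atlas \<Rightarrow> ('g \<Rightarrow> 'q \<Rightarrow> 'q)
    \<Rightarrow> ('q set, 'b::real_normed_vector) atlas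
    \<Rightarrow> ('q \<Rightarrow> ('q, 'm) tvec \<Rightarrow> ('g, 'k::real_normed_vector) tvec)
    \<Rightarrow> 'q \<Rightarrow> ('q set, 'b) tvec \<Rightarrow> ('q, 'm) tvec" where
  "horizontal_lift K Q l B \<AA> q \<delta> =
     (THE X. X \<in> tspace Q q \<and> \<AA> q X = tzero \<and> tmap Q B (orbit K l) q X = \<delta>)"


section \<open>Discrete mechanics\<close>

definition D1 ::
  "('q, 'm::real_normed_vector) atlas \<Rightarrow> ('q \<times> 'q \<Rightarrow> real) \<Rightarrow> 'q \<Rightarrow> 'q \<Rightarrow> ('q, 'm) tvec \<Rightarrow> real" where
  "D1 Q L q0 q1 X = mdiff Q (\<lambda>q. L (q, q1)) q0 X"

definition D2 ::
  "('q, 'm::real_normed_vector) atlas \<Rightarrow> ('q \<times> 'q \<Rightarrow> real) \<Rightarrow> 'q \<Rightarrow> 'q \<Rightarrow> ('q, 'm) tvec \<Rightarrow> real" where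
  "D2 Q L q0 q1 Y = mdiff Q (\<lambda>q. L (q0, q)) q1 Y"

definition D2D1 ::
  "('q, 'm::real_normed_vector) atlas \<Rightarrow> ('q \<times> 'q \<Rightarrow> real) \<Rightarrow> 'q \<Rightarrow> 'q
    \<Rightarrow> ('q, 'm) tvec \<Rightarrow> ('q, 'm) tvec \<Rightarrow> real" where
  "D2D1 Q L q0 q1 X Y = mdiff Q (\<lambda>q. D1 Q L q0 q X) q1 Y"

definition legendre_plus ::
  "('q, 'm::real_normed_vector) atlas \<Rightarrow> ('q \<times> 'q \<Rightarrow> real) \<Rightarrow> 'q \<times> 'q \<Rightarrow> 'q \<times> (('q, 'm) tvec \<Rightarrow> real)" where
  "legendre_plus Q L = (\<lambda>(q0, q1). (q1, \<lambda>Y\<in>tspace Q q1. D2 Q L q0 q1 Y))"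

definition legendre_minus ::
  "('q, 'm::real_normed_vector) atlas \<Rightarrow> ('q \<times> 'q \<Rightarrow> real) \<Rightarrow> 'q \<times> 'q \<Rightarrow> 'q \<times> (('q, 'm) tvec \<Rightarrow> real)" where
  "legendre_minus Q L = (\<lambda>(q0, q1). (q0, \<lambda>X\<in>tspace Q q0. - D1 Q L q0 q1 X))"

definition regular_lagrangian ::
  "('q, 'm::real_normed_vector) atlas \<Rightarrow> ('q \<times> 'q \<Rightarrow> real) \<Rightarrow> bool" where
  "regular_lagrangian Q L \<longleftrightarrow>
     local_diffeo (prod_manifold Q Q) (cotangent_bundle Q) (legendre_plus Q L) \<and>
     local_diffeo (prod_manifold Q Q) (cotangent_bundle Q) (legendre_minus Q L)"

definition invariant_lagrangian ::
  "('g, 'z) monoid_scheme \<Rightarrow> ('q, 'm) atlas \<Rightarrow> ('g \<Rightarrow> 'q \<Rightarrow> 'q) \<Rightarrow> ('q \<times> 'q \<Rightarrow> real) \<Rightarrow> bool" where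
  "invariant_lagrangian G Q l L \<longleftrightarrow>
     (\<forall>g\<in>carrier G. \<forall>q0\<in>mcarrier Q. \<forall>q1\<in>mcarrier Q. L (l g q0, l g q1) = L (q0, q1))"

text \<open>
  In what follows \<open>K\<close> stands for the isotropy group of \<open>\<mu>\<close> and \<open>\<nu>\<close> for the restriction of \<open>\<mu>\<close> to the
  Lie algebra of \<open>K\<close>. For an invariant \<open>L\<close> the momentum map is also given by
  \<open>D2 Q L q0 q1 (inf_gen K AK Q l \<xi> q1)\<close>.
\<close>

definition momentum_map ::
  "('g, 'z) monoid_scheme \<Rightarrow> ('g, 'h::real_normed_vector) atlas \<Rightarrow> ('q, 'm::real_normed_vector) atlas
    \<Rightarrow> ('g \<Rightarrow> 'q \<Rightarrow> 'q) \<Rightarrow> ('q \<times> 'q \<Rightarrow> real) \<Rightarrow> 'q \<Rightarrow> 'q \<Rightarrow> (('g, 'h) tvec \<Rightarrow> real)" where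
  "momentum_map K AK Q l L q0 q1 =
     (\<lambda>\<xi>\<in>lie_algebra K AK. - D1 Q L q0 q1 (inf_gen K AK Q l \<xi> q0))"

definition nondegenerate_on ::
  "('q, 'm::real_normed_vector) tvec set \<Rightarrow> ('q, 'm) tvec set
    \<Rightarrow> (('q, 'm) tvec \<Rightarrow> ('q, 'm) tvec \<Rightarrow> real) \<Rightarrow> bool" where
  "nondegenerate_on V W b \<longleftrightarrow>
     (\<forall>X\<in>V. (\<forall>Y\<in>W. b X Y = 0) \<longrightarrow> X = tzero) \<and>
     (\<forall>Y\<in>W. (\<forall>X\<in>V. b X Y = 0) \<longrightarrow> Y = tzero)"

definition good_symmetries ::
  "('g, 'z) monoid_scheme \<Rightarrow> ('g, 'h::real_normed_vector) atlas \<Rightarrow> ('q, 'm::real_normed_vector) atlas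
    \<Rightarrow> ('g \<Rightarrow> 'q \<Rightarrow> 'q) \<Rightarrow> ('q \<times> 'q \<Rightarrow> real) \<Rightarrow> (('g, 'h) tvec \<Rightarrow> real) \<Rightarrow> bool" where
  "good_symmetries K AK Q l L \<nu> \<longleftrightarrow>
     regular_lagrangian Q L \<and>
     (\<forall>q0\<in>mcarrier Q. \<forall>q1\<in>mcarrier Q.
        nondegenerate_on (orbit_tspace K AK Q l q0) (orbit_tspace K AK Q l q1) (D2D1 Q L q0 q1)) \<and>
     (\<forall>q\<in>mcarrier Q. \<exists>!g. g \<in> carrier K \<and> momentum_map K AK Q l L q (l g q) = \<nu>)"

definition discrete_connection ::
  "('g, 'z) monoid_scheme \<Rightarrow> ('g, 'h::real_normed_vector) atlas \<Rightarrow> ('q, 'm::real_normed_vector) atlas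
    \<Rightarrow> ('g \<Rightarrow> 'q \<Rightarrow> 'q) \<Rightarrow> ('q \<times> 'q \<Rightarrow> real) \<Rightarrow> (('g, 'h) tvec \<Rightarrow> real) \<Rightarrow> 'q \<times> 'q \<Rightarrow> 'g" where
  "discrete_connection K AK Q l L \<nu> = (\<lambda>(q0, q1).
     THE g. g \<in> carrier K \<and> momentum_map K AK Q l L q0 (l (inv\<^bsub>K\<^esub> g) q1) = \<nu>)"

text \<open>The second component of the discrete horizontal lift.\<close>

definition discrete_lift ::
  "('g, 'z) monoid_scheme \<Rightarrow> ('g, 'h::real_normed_vector) atlas \<Rightarrow> ('q, 'm::real_normed_vector) atlas
    \<Rightarrow> ('g \<Rightarrow> 'q \<Rightarrow> 'q) \<Rightarrow> ('q \<times> 'q \<Rightarrow> real) \<Rightarrow> (('g, 'h) tvec \<Rightarrow> real) \<Rightarrow> 'q \<Rightarrow> 'q set \<Rightarrow> 'q" where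
  "discrete_lift K AK Q l L \<nu> q0 \<tau>1 =
     (THE q1. q1 \<in> mcarrier Q \<and> orbit K l q1 = \<tau>1 \<and> momentum_map K AK Q l L q0 q1 = \<nu>)"

definition L_check ::
  "('g, 'z) monoid_scheme \<Rightarrow> ('g, 'h::real_normed_vector) atlas \<Rightarrow> ('q, 'm::real_normed_vector) atlas
    \<Rightarrow> ('g \<Rightarrow> 'q \<Rightarrow> 'q) \<Rightarrow> ('q \<times> 'q \<Rightarrow> real) \<Rightarrow> (('g, 'h) tvec \<Rightarrow> real) \<Rightarrow> 'q \<Rightarrow> 'g \<Rightarrow> 'q set \<Rightarrow> real" where
  "L_check K AK Q l L \<nu> q0 w \<tau>1 = L (q0, l w (discrete_lift K AK Q l L \<nu> q0 \<tau>1))"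

text \<open>
  The force is a function on the quotient: the point \<open>q0\<close> over \<open>\<tau>0\<close> is chosen by the definition,
  and independence of that choice is not built in. Tangent vectors of \<open>B \<times> B\<close> are given as pairs.
\<close>

definition f_breve ::
  "('g, 'z) monoid_scheme \<Rightarrow> ('g, 'h::real_normed_vector) atlas \<Rightarrow> ('q, 'm::real_normed_vector) atlas
    \<Rightarrow> ('g \<Rightarrow> 'q \<Rightarrow> 'q) \<Rightarrow> ('q \<times> 'q \<Rightarrow> real) \<Rightarrow> (('g, 'h) tvec \<Rightarrow> real)
    \<Rightarrow> ('q set, 'b::real_normed_vector) atlas \<Rightarrow> ('q \<Rightarrow> ('q, 'm) tvec \<Rightarrow> ('g, 'h) tvec)
    \<Rightarrow> 'q set \<times> 'q set \<Rightarrow> ('q set, 'b) tvec \<times> ('q set, 'b) tvec \<Rightarrow> real" where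
  "f_breve K AK Q l L \<nu> B \<AA> = (\<lambda>(\<tau>0, \<tau>1) (\<delta>0, \<delta>1).
     let q0 = (SOME q. q \<in> mcarrier Q \<and> orbit K l q = \<tau>0);
         q1 = discrete_lift K AK Q l L \<nu> q0 \<tau>1
     in mdiff AK (\<lambda>w. L_check K AK Q l L \<nu> q0 w \<tau>1) \<one>\<^bsub>K\<^esub>
          (tmap (prod_manifold Q Q) AK (discrete_connection K AK Q l L \<nu>) (q0, q1)
            (tpair Q Q q0 q1
              (horizontal_lift K Q l B \<AA> q0 \<delta>0) (horizontal_lift K Q l B \<AA> q1 \<delta>1))))"

end

theory Submission
  imports Defs
begin

text \<open>
  Write \<open>w \<cdot> q\<close> for the action \<open>l w q\<close>, \<open>\<A>\<close> for the discrete connection, and \<open>Z\<close> for the vector to which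
  \<open>\<nu>\<close> is applied on the right-hand side, the image under the tangent map of \<open>\<A>\<close> of the two horizontal
  lifts. Since \<open>q\<^sub>1\<close> is the discrete lift, \<open>(q\<^sub>0, q\<^sub>1)\<close> has momentum \<open>\<nu>\<close>, hence \<open>\<A> (q\<^sub>0, q\<^sub>1) = e\<close> and \<open>Z\<close>
  lies in the Lie algebra.

  The central computation is \<open>momentum_map_eq_second_partial\<close>: for an invariant Lagrangian the
  derivative of \<open>w \<mapsto> L (q\<^sub>0, w \<cdot> q\<^sub>1)\<close> at the identity in direction \<open>\<xi>\<close> is the momentum of \<open>(q\<^sub>0, q\<^sub>1)\<close>
  evaluated at \<open>\<xi>\<close>. On a discrete lift this is \<open>\<nu> \<xi>\<close>, and \<open>\<xi> = Z\<close> gives the formula.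

  The force is defined with a chosen point over \<open>\<tau>\<^sub>0\<close>, which is \<open>g \<cdot> q\<^sub>0\<close> for some \<open>g\<close> in the isotropy
  group, so independence of this choice is part of the claim. The discrete lift
  (\<open>discrete_lift_translate\<close>) and the horizontal lifts (\<open>horizontal_lift_translate\<close>) are equivariant,
  and \<open>\<A> (g \<cdot> q\<^sub>0, g \<cdot> q\<^sub>1) = g \<A> (q\<^sub>0, q\<^sub>1) g\<^sup>-\<^sup>1\<close>. Differentiating the last identity
  (\<open>tmap_discrete_connection_translate\<close>) shows that replacing \<open>q\<^sub>0\<close> by \<open>g \<cdot> q\<^sub>0\<close> replaces \<open>Z\<close> by \<open>Ad g Z\<close>,
  and \<open>\<nu> (Ad g Z) = \<nu> Z\<close> because \<open>g\<close> fixes \<open>\<mu>\<close> (\<open>restrict_dual_Ad_invariant\<close>).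

  Horizontal lifts are definite descriptions, so their equivariance rests on unique existence
  (\<open>ex1_horizontal_lift\<close>): in a bundle chart the quotient map is a projection, which makes its tangent
  map surjective with kernel the vertical vectors, and the connection is inverse to the infinitesimal
  generators on these. All this uses only the chain rule and the splitting of tangent
  vectors of a product, for maps that are differentiable at a single point.
\<close>

section \<open>Maps that are differentiable at a point\<close>

text \<open>
  Once differentiable chart changes are enough for tangent spaces and tangent maps to behave as
  expected, and this condition passes to products by a direct computation in product charts.
\<close>

definition differentiable_atlas :: "('a, 'm::real_normed_vector) atlas \<Rightarrow> bool" where
  "differentiable_atlas M \<longleftrightarrow> (\<forall>c\<in>M. inj_on (snd c) (fst c)) \<and>
     (\<forall>c\<in>M. \<forall>d\<in>M. open (snd c ` (fst c \<inter> fst d)) \<and>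
        (\<forall>x\<in>snd c ` (fst c \<inter> fst d). (snd d \<circ> chart_inv c) differentiable (at x)))"

text \<open>
  "\<open>P\<close> holds on a neighbourhood of \<open>p\<close>", read off in the charts at \<open>p\<close>, so that it combines directly
  with derivatives of coordinate expressions.
\<close>

definition near :: "('a, 'm::real_normed_vector) atlas \<Rightarrow> 'a \<Rightarrow> ('a \<Rightarrow> bool) \<Rightarrow> bool" where
  "near M p P \<longleftrightarrow> (\<forall>c\<in>charts_at M p. \<forall>\<^sub>F x in nhds (snd c p). P (chart_inv c x))"

text \<open>
  A pointwise notion is used because local trivialisations and their inverses behave well only on an
  open set, while the argument only needs derivatives at one point of it. The first clause on \<open>d\<close>
  is continuity in the weak form that makes the coordinate expressions of \<open>F\<close> meaningful near \<open>p\<close>.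
\<close>

definition diff_at ::
  "('a, 'm::real_normed_vector) atlas \<Rightarrow> ('b, 'n::real_normed_vector) atlas \<Rightarrow> ('a \<Rightarrow> 'b) \<Rightarrow> 'a \<Rightarrow> bool" where
  "diff_at M N F p \<longleftrightarrow> p \<in> mcarrier M \<and> F p \<in> mcarrier N \<and>
     (\<forall>d\<in>charts_at N (F p). near M p (\<lambda>x. F x \<in> fst d) \<and>
        (\<forall>c\<in>charts_at M p. (snd d \<circ> F \<circ> chart_inv c) differentiable (at (snd c p))))"

lemma charts_atD: "c \<in> charts_at M p \<Longrightarrow> c \<in> M" "c \<in> charts_at M p \<Longrightarrow> p \<in> fst c"
  by (auto simp: charts_at_def)

lemma charts_at_nonempty: "p \<in> mcarrier M \<longleftrightarrow> (\<exists>c. c \<in> charts_at M p)"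
  unfolding charts_at_def mcarrier_def by blast

lemma some_chart: "p \<in> mcarrier M \<Longrightarrow> (SOME c. c \<in> charts_at M p) \<in> charts_at M p"
  unfolding charts_at_nonempty by (rule someI_ex)

lemma chart_inv_chart:
  "differentiable_atlas M \<Longrightarrow> c \<in> M \<Longrightarrow> p \<in> fst c \<Longrightarrow> chart_inv c (snd c p) = p"
  by (simp add: differentiable_atlas_def chart_inv_def)

lemma chart_inv_chart_at:
  "differentiable_atlas M \<Longrightarrow> c \<in> charts_at M p \<Longrightarrow> chart_inv c (snd c p) = p"
  using chart_inv_chart charts_atD by metis

lemma eventually_chart_overlap:
  assumes "differentiable_atlas M" "c \<in> charts_at M p" "d \<in> charts_at M p"
  shows "\<forall>\<^sub>F x in nhds (snd c p). x \<in> snd c ` (fst c \<inter> fst d)"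
proof -
  have "open (snd c ` (fst c \<inter> fst d))" "snd c p \<in> snd c ` (fst c \<inter> fst d)"
    using assms by (auto simp: differentiable_atlas_def charts_at_def)
  then show ?thesis by (rule eventually_nhds_in_open)
qed

lemma near_chart_domain:
  assumes "differentiable_atlas M" "d \<in> charts_at M p"
  shows "near M p (\<lambda>x. x \<in> fst d)"
  unfolding near_def
proof
  fix c assume c: "c \<in> charts_at M p"
  from eventually_chart_overlap [OF assms(1) c assms(2)]
  show "\<forall>\<^sub>F x in nhds (snd c p). chart_inv c x \<in> fst d"
    by eventually_elim (use chart_inv_chart [OF assms(1) charts_atD(1) [OF c]] in auto)
qed

lemma near_mono: "near M p P \<Longrightarrow> (\<And>x. P x \<Longrightarrow> R x) \<Longrightarrow> near M p R"
  unfolding near_def by (blast intro: eventually_mono)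

lemma near_conj: "near M p P \<Longrightarrow> near M p R \<Longrightarrow> near M p (\<lambda>x. P x \<and> R x)"
  by (auto simp: near_def intro: eventually_conj)

lemma near_mcarrier:
  assumes "differentiable_atlas M" "\<And>x. x \<in> mcarrier M \<Longrightarrow> P x"
  shows "near M p P"
  unfolding near_def
proof
  fix c assume "c \<in> charts_at M p"
  moreover from this have "near M p P"
    by (rule near_mono [OF near_chart_domain [OF assms(1)]])
      (use assms(2) calculation in \<open>unfold mcarrier_def charts_at_def, blast\<close>)
  ultimately show "\<forall>\<^sub>F x in nhds (snd c p). P (chart_inv c x)"
    by (auto simp: near_def)
qed

lemma near_point:
  assumes "differentiable_atlas M" "p \<in> mcarrier M" "near M p P"
  shows "P p"
proof -
  obtain c where c: "c \<in> charts_at M p" using assms(2) charts_at_nonempty by metis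
  then have "P (chart_inv c (snd c p))"
    using assms(3) eventually_nhds_x_imp_x unfolding near_def by metis
  then show ?thesis using chart_inv_chart_at [OF assms(1) c] by simp
qed

lemma frechet_derivative_compose_ev:
  assumes "f differentiable (at x)" "g differentiable (at (f x))" "\<forall>\<^sub>F y in nhds x. h y = g (f y)"
  shows "h differentiable (at x)"
    and "frechet_derivative h (at x) v = frechet_derivative g (at (f x)) (frechet_derivative f (at x) v)"
proof -
  have "((\<lambda>y. g (f y)) has_derivative
      (\<lambda>v. frechet_derivative g (at (f x)) (frechet_derivative f (at x) v))) (at x)"
    using diff_chain_at [OF iffD1 [OF frechet_derivative_works assms(1)] iffD1 [OF frechet_derivative_works assms(2)]]
    by (simp add: o_def)
  moreover have "\<forall>\<^sub>F y in at x. g (f y) = h y"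
    unfolding eventually_at_filter using assms(3) by (rule eventually_mono) simp
  ultimately have *: "(h has_derivative
      (\<lambda>v. frechet_derivative g (at (f x)) (frechet_derivative f (at x) v))) (at x)"
    by (rule has_derivative_transform_eventually) (use eventually_nhds_x_imp_x [OF assms(3)] in simp_all)
  then show "h differentiable (at x)" by (rule differentiableI)
  show "frechet_derivative h (at x) v = frechet_derivative g (at (f x)) (frechet_derivative f (at x) v)"
    using frechet_derivative_at [OF *] by metis
qed

lemma diff_atD:
  assumes "diff_at M N F p"
  shows "p \<in> mcarrier M" "F p \<in> mcarrier N"
    "d \<in> charts_at N (F p) \<Longrightarrow> near M p (\<lambda>x. F x \<in> fst d)"
    "d \<in> charts_at N (F p) \<Longrightarrow> c \<in> charts_at M p \<Longrightarrow>
       (snd d \<circ> F \<circ> chart_inv c) differentiable (at (snd c p))"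
  using assms by (auto simp: diff_at_def)

lemma eventually_chart_inv_chart:
  assumes "differentiable_atlas M" "differentiable_atlas N" "diff_at M N F p"
    and "c \<in> charts_at M p" "d \<in> charts_at N (F p)"
  shows "\<forall>\<^sub>F x in nhds (snd c p). chart_inv d (snd d (F (chart_inv c x))) = F (chart_inv c x)"
proof -
  have "\<forall>\<^sub>F x in nhds (snd c p). F (chart_inv c x) \<in> fst d"
    using diff_atD(3) [OF assms(3,5)] assms(4) by (auto simp: near_def)
  then show ?thesis
    by eventually_elim (use chart_inv_chart [OF assms(2) charts_atD(1) [OF assms(5)]] in auto)
qed

text \<open>
  Coordinate expressions that are differentiable are continuous, so neighbourhoods pull back.
\<close>

lemma near_compose:
  assumes M: "differentiable_atlas M" and N: "differentiable_atlas N" and F: "diff_at M N F p"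
    and P: "near N (F p) P"
  shows "near M p (\<lambda>x. P (F x))"
  unfolding near_def
proof
  fix c assume c: "c \<in> charts_at M p"
  obtain d where d: "d \<in> charts_at N (F p)" using diff_atD(2) [OF F] charts_at_nonempty by metis
  have "isCont (snd d \<circ> F \<circ> chart_inv c) (snd c p)"
    using diff_atD(4) [OF F d c] differentiable_imp_continuous_within by blast
  then have "filterlim (snd d \<circ> F \<circ> chart_inv c) (nhds ((snd d \<circ> F \<circ> chart_inv c) (snd c p))) (nhds (snd c p))"
    by (simp only: isCont_def tendsto_at_iff_tendsto_nhds)
  then have "filterlim (snd d \<circ> F \<circ> chart_inv c) (nhds (snd d (F p))) (nhds (snd c p))"
    using chart_inv_chart_at [OF M c] by simp
  then have "\<forall>\<^sub>F x in nhds (snd c p). P (chart_inv d ((snd d \<circ> F \<circ> chart_inv c) x))"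
    using P d eventually_compose_filterlim unfolding near_def by blast
  with eventually_chart_inv_chart [OF M N F c d]
  show "\<forall>\<^sub>F x in nhds (snd c p). P (F (chart_inv c x))"
    by eventually_elim simp
qed

lemma coordinates_compose:
  assumes M: "differentiable_atlas M" and N: "differentiable_atlas N"
    and F: "diff_at M N F p" and G: "diff_at N R H (F p)"
    and c: "c \<in> charts_at M p" and d: "d \<in> charts_at N (F p)" and e: "e \<in> charts_at R (H (F p))"
  shows "(snd e \<circ> (\<lambda>x. H (F x)) \<circ> chart_inv c) differentiable (at (snd c p))"
    and "frechet_derivative (snd e \<circ> (\<lambda>x. H (F x)) \<circ> chart_inv c) (at (snd c p)) v =
      frechet_derivative (snd e \<circ> H \<circ> chart_inv d) (at (snd d (F p)))
        (frechet_derivative (snd d \<circ> F \<circ> chart_inv c) (at (snd c p)) v)"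
proof -
  have p: "(snd d \<circ> F \<circ> chart_inv c) (snd c p) = snd d (F p)"
    using chart_inv_chart_at [OF M c] by simp
  have "\<forall>\<^sub>F x in nhds (snd c p). (snd e \<circ> (\<lambda>x. H (F x)) \<circ> chart_inv c) x =
      (snd e \<circ> H \<circ> chart_inv d) ((snd d \<circ> F \<circ> chart_inv c) x)"
    using eventually_chart_inv_chart [OF M N F c d] by eventually_elim simp
  from frechet_derivative_compose_ev [OF diff_atD(4) [OF F d c] _ this, unfolded p, OF diff_atD(4) [OF G e d]]
  show "(snd e \<circ> (\<lambda>x. H (F x)) \<circ> chart_inv c) differentiable (at (snd c p))"
    and "frechet_derivative (snd e \<circ> (\<lambda>x. H (F x)) \<circ> chart_inv c) (at (snd c p)) v =
      frechet_derivative (snd e \<circ> H \<circ> chart_inv d) (at (snd d (F p)))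
        (frechet_derivative (snd d \<circ> F \<circ> chart_inv c) (at (snd c p)) v)"
    by blast+
qed

lemma diff_at_compose:
  assumes M: "differentiable_atlas M" and N: "differentiable_atlas N"
    and F: "diff_at M N F p" and G: "diff_at N R H (F p)"
  shows "diff_at M R (\<lambda>x. H (F x)) p"
  unfolding diff_at_def
proof (intro conjI ballI)
  show "p \<in> mcarrier M" "H (F p) \<in> mcarrier R" using diff_atD F G by metis+
  fix e assume e: "e \<in> charts_at R (H (F p))"
  show "near M p (\<lambda>x. H (F x) \<in> fst e)"
    using near_compose [OF M N F] diff_atD(3) [OF G e] by blast
  obtain d where d: "d \<in> charts_at N (F p)" using diff_atD(2) [OF F] charts_at_nonempty by metis
  fix c assume c: "c \<in> charts_at M p"
  show "(snd e \<circ> (\<lambda>x. H (F x)) \<circ> chart_inv c) differentiable (at (snd c p))"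
    using coordinates_compose(1) [OF M N F G c d e] .
qed

text \<open>
  Both sides depend on \<open>X\<close> only through its coordinates in the chart that \<open>tmap\<close> selects at \<open>p\<close>, so
  this is the chain rule for coordinate expressions.
\<close>

lemma tmap_compose:
  assumes M: "differentiable_atlas M" and N: "differentiable_atlas N"
    and F: "diff_at M N F p" and G: "diff_at N R H (F p)"
  shows "tmap N R H (F p) (tmap M N F p X) = tmap M R (\<lambda>x. H (F x)) p X"
proof -
  note c = some_chart [OF diff_atD(1) [OF F]] and d = some_chart [OF diff_atD(2) [OF F]]
  show ?thesis
    using coordinates_compose(2) [OF M N F G c d] d by (auto simp: tmap_def Let_def fun_eq_iff)
qed

lemma differentiable_atlas_change:
  assumes "differentiable_atlas M" "c \<in> charts_at M p" "d \<in> charts_at M p"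
  shows "(snd d \<circ> chart_inv c) differentiable (at (snd c p))"
  using assms unfolding differentiable_atlas_def charts_at_def by blast

text \<open>
  The transformation law is oriented towards removing derivatives of chart changes: as a rewrite rule
  from left to right the equation in the definition of \<open>tspace\<close> does not terminate.
\<close>

lemma tspace_transform:
  assumes "X \<in> tspace M p" "c \<in> charts_at M p" "d \<in> charts_at M p"
  shows "frechet_derivative (snd d \<circ> chart_inv c) (at (snd c p)) (X c) = X d"
  using bspec [OF bspec [OF conjunct1 [OF CollectD [OF assms(1) [unfolded tspace_def]]] assms(2)] assms(3)]
  by (rule sym)

lemma tspace_off_chart:
  assumes "X \<in> tspace M p" "c \<notin> charts_at M p"
  shows "X c = 0"
  using spec [OF conjunct2 [OF CollectD [OF assms(1) [unfolded tspace_def]]], of c] assms(2) by (rule mp)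

lemma tspaceI:
  assumes "\<And>c d. c \<in> charts_at M p \<Longrightarrow> d \<in> charts_at M p \<Longrightarrow>
      X d = frechet_derivative (snd d \<circ> chart_inv c) (at (snd c p)) (X c)"
    and "\<And>c. c \<notin> charts_at M p \<Longrightarrow> X c = 0"
  shows "X \<in> tspace M p"
  unfolding tspace_def mem_Collect_eq by (intro conjI ballI allI impI assms)

lemma diff_at_id:
  fixes M :: "('a, 'm::real_normed_vector) atlas"
  assumes M: "differentiable_atlas M" and p: "p \<in> mcarrier M"
  shows "diff_at M M (\<lambda>x. x) p"
  unfolding diff_at_def
proof (intro conjI ballI p)
  fix d assume d: "d \<in> charts_at M p"
  show "near M p (\<lambda>x. x \<in> fst d)" using near_chart_domain [OF M d] .
  have *: "f \<circ> (\<lambda>x. x) \<circ> g = f \<circ> g" for f :: "'a \<Rightarrow> 'm" and g :: "'m \<Rightarrow> 'a"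
    by (simp add: fun_eq_iff)
  fix c assume c: "c \<in> charts_at M p"
  show "(snd d \<circ> (\<lambda>x. x) \<circ> chart_inv c) differentiable (at (snd c p))"
    unfolding * using differentiable_atlas_change [OF M c d] .
qed

lemma tmap_id:
  fixes M :: "('a, 'm::real_normed_vector) atlas"
  assumes "p \<in> mcarrier M" "X \<in> tspace M p"
  shows "tmap M M (\<lambda>x. x) p X = X"
proof
  fix d
  have *: "f \<circ> (\<lambda>x. x) \<circ> g = f \<circ> g" for f :: "'a \<Rightarrow> 'm" and g :: "'m \<Rightarrow> 'a"
    by (simp add: fun_eq_iff)
  show "tmap M M (\<lambda>x. x) p X d = X d"
  proof (cases "d \<in> charts_at M p")
    case True
    then show ?thesis
      using tspace_transform [OF assms(2) some_chart [OF assms(1)] True] by (simp only: tmap_def Let_def * if_True)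
  next
    case False
    then show ?thesis
      using tspace_off_chart [OF assms(2) False] by (simp only: tmap_def Let_def if_False)
  qed
qed

lemma diff_at_const:
  assumes "p \<in> mcarrier M" "y \<in> mcarrier N"
  shows "diff_at M N (\<lambda>x. y) p"
  unfolding diff_at_def near_def comp_def
proof (intro conjI ballI assms)
  fix d assume "d \<in> charts_at N y"
  then show "\<forall>\<^sub>F x in nhds (snd c p). y \<in> fst d" for c
    using charts_atD(2) by simp
qed simp

lemma tmap_const:
  fixes M :: "('a, 'm::real_normed_vector) atlas" and N :: "('b, 'n::real_normed_vector) atlas"
  shows "tmap M N (\<lambda>x. y) p X = tzero"
proof
  fix d
  have "g \<circ> (\<lambda>x. y) \<circ> f = (\<lambda>x. g y)" for f :: "'m \<Rightarrow> 'a" and g :: "'b \<Rightarrow> 'n" by (simp add: fun_eq_iff)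
  then show "tmap M N (\<lambda>x. y) p X d = tzero d" by (simp add: tmap_def tzero_def Let_def)
qed

lemma has_derivative_cong_nhds:
  assumes "\<forall>\<^sub>F y in nhds x. f y = g y"
  shows "(f has_derivative D) (at x) \<longleftrightarrow> (g has_derivative D) (at x)"
proof -
  have "(g has_derivative D) (at x)"
    if "(f has_derivative D) (at x)" "\<forall>\<^sub>F y in nhds x. f y = g y" for f g :: "'a \<Rightarrow> 'b"
  proof -
    have "\<forall>\<^sub>F y in at x. f y = g y"
      unfolding eventually_at_filter using that(2) by (rule eventually_mono) simp
    with that(1) show ?thesis
      by (rule has_derivative_transform_eventually) (use eventually_nhds_x_imp_x [OF that(2)] in simp_all)
  qed
  from this [of f g] this [of g f] show ?thesis
    using assms eventually_mono [OF assms, of "\<lambda>y. g y = f y"] by auto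
qed

lemma coordinates_cong:
  assumes "near M p (\<lambda>x. F x = F' x)" "c \<in> charts_at M p"
  shows "(f \<circ> F \<circ> chart_inv c has_derivative D) (at (snd c p)) \<longleftrightarrow>
    (f \<circ> F' \<circ> chart_inv c has_derivative D) (at (snd c p))"
proof (rule has_derivative_cong_nhds)
  have "\<forall>\<^sub>F x in nhds (snd c p). F (chart_inv c x) = F' (chart_inv c x)"
    using assms unfolding near_def by blast
  then show "\<forall>\<^sub>F x in nhds (snd c p). (f \<circ> F \<circ> chart_inv c) x = (f \<circ> F' \<circ> chart_inv c) x"
    by (rule eventually_mono) simp
qed

text \<open>
  Tangent maps depend only on germs. All equalities between tangent maps of different composites
  below come from this lemma and the chain rule.
\<close>

lemma tmap_cong:
  assumes "differentiable_atlas M" "p \<in> mcarrier M" "near M p (\<lambda>x. F x = F' x)"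
  shows "tmap M N F p X = tmap M N F' p X"
  unfolding tmap_def Let_def frechet_derivative_def
    coordinates_cong [OF assms(3) some_chart [OF assms(2)]] near_point [OF assms] ..

lemma tmap_in_tspace:
  fixes N :: "('b, 'n::real_normed_vector) atlas"
  assumes M: "differentiable_atlas M" and N: "differentiable_atlas N" and F: "diff_at M N F p"
  shows "tmap M N F p X \<in> tspace N (F p)"
proof (rule tspaceI)
  fix d e assume de: "d \<in> charts_at N (F p)" "e \<in> charts_at N (F p)"
  have *: "f \<circ> (\<lambda>x. x) \<circ> g = f \<circ> g" for f :: "'b \<Rightarrow> 'n" and g :: "'n \<Rightarrow> 'b"
    by (simp add: fun_eq_iff)
  show "tmap M N F p X e = frechet_derivative (snd e \<circ> chart_inv d) (at (snd d (F p))) (tmap M N F p X d)"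
    unfolding tmap_def Let_def if_P [OF de(1)] if_P [OF de(2)]
    using coordinates_compose(2) [OF M N F diff_at_id [OF N diff_atD(2) [OF F]] some_chart [OF diff_atD(1) [OF F]] de]
    unfolding * .
qed (simp add: tmap_def Let_def)

text \<open>
  One chart determines the vector by the transformation law.
\<close>

lemma tspace_eqI:
  assumes "X \<in> tspace M p" "Y \<in> tspace M p" "c \<in> charts_at M p" "X c = Y c"
  shows "X = Y"
proof
  fix d
  show "X d = Y d"
    using assms tspace_transform [OF assms(1,3), of d] tspace_transform [OF assms(2,3), of d]
      tspace_off_chart by metis
qed

lemma tadd_in_tspace:
  assumes M: "differentiable_atlas M" and X: "X \<in> tspace M p" and Y: "Y \<in> tspace M p"
  shows "tadd X Y \<in> tspace M p"
proof (rule tspaceI)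
  show "(tadd X Y) d = frechet_derivative (snd d \<circ> chart_inv c) (at (snd c p)) ((tadd X Y) c)"
    if "c \<in> charts_at M p" "d \<in> charts_at M p" for c d
    using linear_add [OF linear_frechet_derivative [OF differentiable_atlas_change [OF M that]]]
    by (simp add: tadd_def tspace_transform [OF X that] tspace_transform [OF Y that])
  show "(tadd X Y) c = 0" if "c \<notin> charts_at M p" for c
    using that by (simp add: tadd_def tspace_off_chart [OF X] tspace_off_chart [OF Y])
qed

lemma tscale_in_tspace:
  assumes M: "differentiable_atlas M" and X: "X \<in> tspace M p"
  shows "tscale r X \<in> tspace M p"
proof (rule tspaceI)
  show "(tscale r X) d = frechet_derivative (snd d \<circ> chart_inv c) (at (snd c p)) ((tscale r X) c)"
    if "c \<in> charts_at M p" "d \<in> charts_at M p" for c d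
    using linear_cmul [OF linear_frechet_derivative [OF differentiable_atlas_change [OF M that]]]
    by (simp add: tscale_def tspace_transform [OF X that])
  show "(tscale r X) c = 0" if "c \<notin> charts_at M p" for c
    using that by (simp add: tscale_def tspace_off_chart [OF X])
qed

lemma tzero_in_tspace:
  assumes M: "differentiable_atlas M"
  shows "tzero \<in> tspace M p"
proof (rule tspaceI)
  show "(tzero) d = frechet_derivative (snd d \<circ> chart_inv c) (at (snd c p)) ((tzero) c)"
    if "c \<in> charts_at M p" "d \<in> charts_at M p" for c d
    using linear_0 [OF linear_frechet_derivative [OF differentiable_atlas_change [OF M that]]]
    by (simp add: tzero_def )
  show "(tzero) c = 0" if "c \<notin> charts_at M p" for c
    using that by (simp add: tzero_def )
qed

lemma tmap_tadd:
  assumes "diff_at M N F p"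
  shows "tmap M N F p (tadd X Y) = tadd (tmap M N F p X) (tmap M N F p Y)"
proof
  fix d
  show "tmap M N F p (tadd X Y) d = (tadd (tmap M N F p X) (tmap M N F p Y)) d"
  proof (cases "d \<in> charts_at N (F p)")
    case True
    note D = linear_frechet_derivative [OF diff_atD(4) [OF assms True some_chart [OF diff_atD(1) [OF assms]]]]
    show ?thesis
      using True linear_add [OF D] by (simp add: tmap_def tadd_def Let_def)
  qed (simp add: tmap_def tadd_def Let_def)
qed

lemma tmap_tscale:
  assumes "diff_at M N F p"
  shows "tmap M N F p (tscale r X) = tscale r (tmap M N F p X)"
proof
  fix d
  show "tmap M N F p (tscale r X) d = (tscale r (tmap M N F p X)) d"
  proof (cases "d \<in> charts_at N (F p)")
    case True
    note D = linear_frechet_derivative [OF diff_atD(4) [OF assms True some_chart [OF diff_atD(1) [OF assms]]]]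
    show ?thesis
      using True linear_cmul [OF D] by (simp add: tmap_def tscale_def Let_def)
  qed (simp add: tmap_def tscale_def Let_def)
qed

lemma tmap_tzero:
  assumes "diff_at M N F p"
  shows "tmap M N F p tzero = tzero"
proof
  fix d
  show "tmap M N F p tzero d = (tzero) d"
  proof (cases "d \<in> charts_at N (F p)")
    case True
    note D = linear_frechet_derivative [OF diff_atD(4) [OF assms True some_chart [OF diff_atD(1) [OF assms]]]]
    show ?thesis
      using True linear_0 [OF D] by (simp add: tmap_def tzero_def Let_def)
  qed (simp add: tmap_def tzero_def Let_def)
qed

lemma tadd_tzero [simp]: "tadd X tzero = X" "tadd tzero X = X"
  by (simp_all add: tadd_def tzero_def)

section \<open>Products\<close>

lemma charts_at_prodE:
  assumes "e \<in> charts_at (prod_manifold M N) z"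
  obtains c d where "c \<in> charts_at M (fst z)" "d \<in> charts_at N (snd z)"
    "e = (fst c \<times> fst d, map_prod (snd c) (snd d))"
proof -
  obtain c d where cd: "c \<in> M" "d \<in> N" and e: "e = (fst c \<times> fst d, map_prod (snd c) (snd d))"
    using charts_atD(1) [OF assms] unfolding prod_manifold_def by blast
  have "z \<in> fst c \<times> fst d"
    using charts_atD(2) [OF assms] by (simp add: e)
  then have "fst z \<in> fst c" "snd z \<in> fst d"
    by (simp_all add: mem_Times_iff)
  then show thesis
    using that [of c d] cd e by (simp add: charts_at_def)
qed

lemma charts_at_prodI:
  assumes "c \<in> charts_at M p" "d \<in> charts_at N q"
  shows "(fst c \<times> fst d, map_prod (snd c) (snd d)) \<in> charts_at (prod_manifold M N) (p, q)"
proof -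
  have "(fst c \<times> fst d, map_prod (snd c) (snd d)) \<in> prod_manifold M N"
    unfolding prod_manifold_def mem_Collect_eq
    using charts_atD(1) [OF assms(1)] charts_atD(1) [OF assms(2)]
    by (intro exI [of _ c] exI [of _ d] conjI refl)
  then show ?thesis
    using charts_atD(2) [OF assms(1)] charts_atD(2) [OF assms(2)] by (simp add: charts_at_def)
qed

lemma mcarrier_prod [simp]: "mcarrier (prod_manifold M N) = mcarrier M \<times> mcarrier N"
proof (rule Set.set_eqI)
  fix z
  have "(\<exists>e. e \<in> charts_at (prod_manifold M N) z) \<longleftrightarrow>
      (\<exists>c. c \<in> charts_at M (fst z)) \<and> (\<exists>d. d \<in> charts_at N (snd z))"
  proof (intro iffI conjI)
    assume "\<exists>e. e \<in> charts_at (prod_manifold M N) z"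
    then obtain e where "e \<in> charts_at (prod_manifold M N) z" ..
    then obtain c d where "c \<in> charts_at M (fst z)" "d \<in> charts_at N (snd z)"
      by (rule charts_at_prodE)
    then show "\<exists>c. c \<in> charts_at M (fst z)" "\<exists>d. d \<in> charts_at N (snd z)" by blast+
  next
    assume "(\<exists>c. c \<in> charts_at M (fst z)) \<and> (\<exists>d. d \<in> charts_at N (snd z))"
    then obtain c d where "c \<in> charts_at M (fst z)" "d \<in> charts_at N (snd z)" by blast
    from charts_at_prodI [OF this] show "\<exists>e. e \<in> charts_at (prod_manifold M N) z"
      unfolding prod.collapse by (rule exI)
  qed
  then show "z \<in> mcarrier (prod_manifold M N) \<longleftrightarrow> z \<in> mcarrier M \<times> mcarrier N"
    by (simp only: charts_at_nonempty mem_Times_iff)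
qed

lemma chart_inv_prod:
  assumes "inj_on (snd c) (fst c)" "inj_on (snd d) (fst d)" "x \<in> snd c ` fst c" "y \<in> snd d ` fst d"
  shows "chart_inv (fst c \<times> fst d, map_prod (snd c) (snd d)) (x, y) = (chart_inv c x, chart_inv d y)"
proof -
  have "inj_on (map_prod (snd c) (snd d)) (fst c \<times> fst d)"
    using assms(1,2) by (rule map_prod_inj_on)
  then show ?thesis
    using assms unfolding chart_inv_def
    by (intro inv_into_f_eq) (auto simp: f_inv_into_f inv_into_into)
qed

lemma eventually_chart_inv_prod:
  assumes "differentiable_atlas M" "differentiable_atlas N"
    and "c \<in> charts_at M p" "d \<in> charts_at N q"
  shows "\<forall>\<^sub>F z in nhds (snd c p, snd d q).
    chart_inv (fst c \<times> fst d, map_prod (snd c) (snd d)) z = (chart_inv c (fst z), chart_inv d (snd z))"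
proof -
  have "\<forall>\<^sub>F z in nhds (snd c p, snd d q). fst z \<in> snd c ` fst c \<and> snd z \<in> snd d ` fst d"
    unfolding nhds_prod
    using eventually_prodI [OF eventually_chart_overlap [OF assms(1,3,3)] eventually_chart_overlap [OF assms(2,4,4)]]
    by simp
  then show ?thesis
  proof eventually_elim
    case (elim z)
    then show ?case
      using chart_inv_prod [of c d "fst z" "snd z"] assms by (auto simp: differentiable_atlas_def charts_at_def)
  qed
qed

lemma differentiable_Pair:
  assumes "f differentiable (at x)" "g differentiable (at x)"
  shows "(\<lambda>x. (f x, g x)) differentiable (at x)"
  using has_derivative_Pair [OF iffD1 [OF frechet_derivative_works assms(1)] iffD1 [OF frechet_derivative_works assms(2)]]
  by (rule differentiableI)

lemma differentiable_fst_compose: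
  assumes "f differentiable (at (fst z))"
  shows "(\<lambda>z. f (fst z)) differentiable (at z)"
  by (rule frechet_derivative_compose_ev(1) [OF bounded_linear_imp_differentiable [OF bounded_linear_fst] assms]) simp

lemma differentiable_snd_compose:
  assumes "f differentiable (at (snd z))"
  shows "(\<lambda>z. f (snd z)) differentiable (at z)"
  by (rule frechet_derivative_compose_ev(1) [OF bounded_linear_imp_differentiable [OF bounded_linear_snd] assms]) simp

lemma differentiable_atlas_prod:
  assumes M: "differentiable_atlas M" and N: "differentiable_atlas N"
  shows "differentiable_atlas (prod_manifold M N)"
  unfolding differentiable_atlas_def
proof (intro conjI ballI)
  fix e assume "e \<in> prod_manifold M N"
  then obtain c d where "c \<in> M" "d \<in> N" "e = (fst c \<times> fst d, map_prod (snd c) (snd d))"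
    unfolding prod_manifold_def by blast
  then show "inj_on (snd e) (fst e)"
    using M N by (simp add: differentiable_atlas_def map_prod_inj_on)
next
  fix e e' assume "e \<in> prod_manifold M N" "e' \<in> prod_manifold M N"
  then obtain c d c' d' where cd: "c \<in> M" "d \<in> N" "c' \<in> M" "d' \<in> N"
    and e: "e = (fst c \<times> fst d, map_prod (snd c) (snd d))"
    and e': "e' = (fst c' \<times> fst d', map_prod (snd c') (snd d'))"
    by (auto simp: prod_manifold_def)
  have *: "snd e ` (fst e \<inter> fst e') = snd c ` (fst c \<inter> fst c') \<times> snd d ` (fst d \<inter> fst d')"
    by (simp add: e e' Times_Int_Times map_prod_surj_on)
  show "open (snd e ` (fst e \<inter> fst e'))"
    unfolding * using M N cd by (intro open_Times) (auto simp: differentiable_atlas_def)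
  fix z assume "z \<in> snd e ` (fst e \<inter> fst e')"
  then obtain p q where pq: "p \<in> fst c \<inter> fst c'" "q \<in> fst d \<inter> fst d'" and z: "z = (snd c p, snd d q)"
    unfolding * by auto
  have ch: "c \<in> charts_at M p" "c' \<in> charts_at M p" "d \<in> charts_at N q" "d' \<in> charts_at N q"
    using cd pq by (auto simp: charts_at_def)
  have "(\<lambda>z. ((snd c' \<circ> chart_inv c) (fst z), (snd d' \<circ> chart_inv d) (snd z))) differentiable (at z)"
    using differentiable_atlas_change [OF M ch(1,2)] differentiable_atlas_change [OF N ch(3,4)]
    by (intro differentiable_Pair differentiable_fst_compose differentiable_snd_compose) (simp_all add: z del: o_apply)
  moreover have "\<forall>\<^sub>F x in nhds z. (snd e' \<circ> chart_inv e) x =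
      ((snd c' \<circ> chart_inv c) (fst x), (snd d' \<circ> chart_inv d) (snd x))"
    using eventually_chart_inv_prod [OF M N ch(1,3)] unfolding z e e'
    by eventually_elim simp
  ultimately show "(snd e' \<circ> chart_inv e) differentiable (at z)"
    using frechet_derivative_compose_ev(1) [of _ z "\<lambda>x. x"] differentiable_ident by blast
qed

lemma diff_at_fst:
  assumes M: "differentiable_atlas M" and N: "differentiable_atlas N"
    and p: "p \<in> mcarrier M" and q: "q \<in> mcarrier N"
  shows "diff_at (prod_manifold M N) M fst (p, q)"
proof -
  have *: "(\<forall>\<^sub>F x in nhds (snd e (p, q)). fst (chart_inv e x) \<in> fst d) \<and>
      (snd d \<circ> fst \<circ> chart_inv e) differentiable (at (snd e (p, q)))"
    if d: "d \<in> charts_at M p" and e_chart: "e \<in> charts_at (prod_manifold M N) (p, q)" for d e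
  proof -
    obtain c c' where c: "c \<in> charts_at M p" "c' \<in> charts_at N q"
      and e: "e = (fst c \<times> fst c', map_prod (snd c) (snd c'))"
      by (metis charts_at_prodE [OF e_chart] fst_conv snd_conv)
    have ev: "\<forall>\<^sub>F x in nhds (snd e (p, q)). fst (chart_inv e x) = chart_inv c (fst x)"
      using eventually_chart_inv_prod [OF M N c] unfolding e by (auto elim: eventually_mono)
    have "\<forall>\<^sub>F x in nhds (snd c p, snd c' q). chart_inv c (fst x) \<in> fst d"
      unfolding nhds_prod using near_chart_domain [OF M d] c(1)
      by (intro eventually_compose_filterlim [OF _ filterlim_fst]) (simp add: near_def)
    then have "\<forall>\<^sub>F x in nhds (snd e (p, q)). fst (chart_inv e x) \<in> fst d"
      using ev unfolding e by (auto elim: eventually_elim2)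
    moreover have "(\<lambda>x. (snd d \<circ> chart_inv c) (fst x)) differentiable (at (snd e (p, q)))"
      using differentiable_atlas_change [OF M c(1) d] by (intro differentiable_fst_compose) (simp add: e del: o_apply)
    moreover have "\<forall>\<^sub>F x in nhds (snd e (p, q)). (snd d \<circ> fst \<circ> chart_inv e) x = (snd d \<circ> chart_inv c) (fst x)"
      using ev by eventually_elim simp
    ultimately show ?thesis
      using frechet_derivative_compose_ev(1) [OF differentiable_ident] by blast
  qed
  show ?thesis
    unfolding diff_at_def near_def using p q * by simp
qed

lemma diff_at_snd:
  assumes M: "differentiable_atlas M" and N: "differentiable_atlas N"
    and p: "p \<in> mcarrier M" and q: "q \<in> mcarrier N"
  shows "diff_at (prod_manifold M N) N snd (p, q)"
proof -
  have *: "(\<forall>\<^sub>F x in nhds (snd e (p, q)). snd (chart_inv e x) \<in> fst d) \<and>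
      (snd d \<circ> snd \<circ> chart_inv e) differentiable (at (snd e (p, q)))"
    if d: "d \<in> charts_at N q" and e_chart: "e \<in> charts_at (prod_manifold M N) (p, q)" for d e
  proof -
    obtain c c' where c: "c \<in> charts_at M p" "c' \<in> charts_at N q"
      and e: "e = (fst c \<times> fst c', map_prod (snd c) (snd c'))"
      by (metis charts_at_prodE [OF e_chart] fst_conv snd_conv)
    have ev: "\<forall>\<^sub>F x in nhds (snd e (p, q)). snd (chart_inv e x) = chart_inv c' (snd x)"
      using eventually_chart_inv_prod [OF M N c] unfolding e by (auto elim: eventually_mono)
    have "\<forall>\<^sub>F x in nhds (snd c p, snd c' q). chart_inv c' (snd x) \<in> fst d"
      unfolding nhds_prod using near_chart_domain [OF N d] c(2)
      by (intro eventually_compose_filterlim [OF _ filterlim_snd]) (simp add: near_def)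
    then have "\<forall>\<^sub>F x in nhds (snd e (p, q)). snd (chart_inv e x) \<in> fst d"
      using ev unfolding e by (auto elim: eventually_elim2)
    moreover have "(\<lambda>x. (snd d \<circ> chart_inv c') (snd x)) differentiable (at (snd e (p, q)))"
      using differentiable_atlas_change [OF N c(2) d] by (intro differentiable_snd_compose) (simp add: e del: o_apply)
    moreover have "\<forall>\<^sub>F x in nhds (snd e (p, q)). (snd d \<circ> snd \<circ> chart_inv e) x = (snd d \<circ> chart_inv c') (snd x)"
      using ev by eventually_elim simp
    ultimately show ?thesis
      using frechet_derivative_compose_ev(1) [OF differentiable_ident] by blast
  qed
  show ?thesis
    unfolding diff_at_def near_def using p q * by simp
qed

lemma diff_at_Pair:
  assumes F: "diff_at R M F r" and H: "diff_at R N H r"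
  shows "diff_at R (prod_manifold M N) (\<lambda>x. (F x, H x)) r"
  unfolding diff_at_def
proof (intro conjI ballI)
  show "r \<in> mcarrier R" "(F r, H r) \<in> mcarrier (prod_manifold M N)"
    using diff_atD(1,2) [OF F] diff_atD(2) [OF H] by simp_all
  fix e assume "e \<in> charts_at (prod_manifold M N) (F r, H r)"
  then obtain d d' where d: "d \<in> charts_at M (F r)" "d' \<in> charts_at N (H r)"
    and e: "e = (fst d \<times> fst d', map_prod (snd d) (snd d'))"
    by (metis charts_at_prodE fst_conv snd_conv)
  show "near R r (\<lambda>x. (F x, H x) \<in> fst e)"
    using near_conj [OF diff_atD(3) [OF F d(1)] diff_atD(3) [OF H d(2)]] by (simp add: e)
  fix c assume c: "c \<in> charts_at R r"
  have "snd e \<circ> (\<lambda>x. (F x, H x)) \<circ> chart_inv c =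
      (\<lambda>x. ((snd d \<circ> F \<circ> chart_inv c) x, (snd d' \<circ> H \<circ> chart_inv c) x))"
    by (simp add: e fun_eq_iff)
  then show "(snd e \<circ> (\<lambda>x. (F x, H x)) \<circ> chart_inv c) differentiable (at (snd c r))"
    using differentiable_Pair [OF diff_atD(4) [OF F d(1) c] diff_atD(4) [OF H d(2) c]] by simp
qed

lemma tmap_has_derivative:
  assumes "((snd d \<circ> F \<circ> chart_inv c) has_derivative D) (at (snd c p))"
    and "c = (SOME c. c \<in> charts_at M p)" "d \<in> charts_at N (F p)"
  shows "tmap M N F p X d = D (X c)"
  using frechet_derivative_at [OF assms(1)] assms(2,3) by (simp add: tmap_def Let_def)

text \<open>
  In the product chart the derivatives of \<open>(x, y) \<mapsto> (x, q)\<close> and \<open>(x, y) \<mapsto> (p, y)\<close> are the two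
  coordinate projections, which add up to the identity. Hence a tangent vector of a product is
  determined by its two projections.
\<close>

lemma tangent_prod_split:
  assumes M: "differentiable_atlas M" and N: "differentiable_atlas N"
    and p: "p \<in> mcarrier M" and q: "q \<in> mcarrier N"
    and Z: "Z \<in> tspace (prod_manifold M N) (p, q)"
  shows "Z = tadd (tmap M (prod_manifold M N) (\<lambda>x. (x, q)) p (tmap (prod_manifold M N) M fst (p, q) Z))
    (tmap N (prod_manifold M N) (\<lambda>y. (p, y)) q (tmap (prod_manifold M N) N snd (p, q) Z))"
    (is "Z = tadd ?A ?B")
proof -
  note MN = differentiable_atlas_prod [OF M N]
  define e where "e = (SOME e. e \<in> charts_at (prod_manifold M N) (p, q))"
  have e_chart: "e \<in> charts_at (prod_manifold M N) (p, q)"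
    unfolding e_def using p q by (intro some_chart) simp
  obtain c c' where c: "c \<in> charts_at M p" "c' \<in> charts_at N q"
    and e: "e = (fst c \<times> fst c', map_prod (snd c) (snd c'))"
    by (metis charts_at_prodE [OF e_chart] fst_conv snd_conv)
  note ev = eventually_chart_inv_prod [OF M N c, folded e]
  have in1: "diff_at M (prod_manifold M N) (\<lambda>x. (x, q)) p"
    using M p q by (intro diff_at_Pair diff_at_id diff_at_const)
  have in2: "diff_at N (prod_manifold M N) (\<lambda>y. (p, y)) q"
    using N p q by (intro diff_at_Pair diff_at_id diff_at_const)
  have c_ev: "\<forall>\<^sub>F x in nhds (snd e (p, q)). fst x \<in> snd c ` fst c \<and> snd x \<in> snd c' ` fst c'"
    unfolding e snd_conv map_prod_simp nhds_prod
    using eventually_prodI [OF eventually_chart_overlap [OF M c(1) c(1)] eventually_chart_overlap [OF N c(2) c(2)]]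
    by simp
  have "?A = tmap (prod_manifold M N) (prod_manifold M N) (\<lambda>z. (fst z, q)) (p, q) Z"
    using tmap_compose [OF MN M diff_at_fst [OF M N p q], of "prod_manifold M N" "\<lambda>x. (x, q)"] in1 by simp
  moreover have "((snd e \<circ> (\<lambda>z. (fst z, q)) \<circ> chart_inv e) has_derivative (\<lambda>v. (fst v, 0))) (at (snd e (p, q)))"
  proof (rule iffD2 [OF has_derivative_cong_nhds])
    show "\<forall>\<^sub>F x in nhds (snd e (p, q)). (snd e \<circ> (\<lambda>z. (fst z, q)) \<circ> chart_inv e) x = (fst x, snd c' q)"
      using ev c_ev unfolding e snd_conv map_prod_simp
      by eventually_elim (use chart_inv_chart [OF M charts_atD(1) [OF c(1)]] in auto)
    show "((\<lambda>x. (fst x, snd c' q)) has_derivative (\<lambda>v. (fst v, 0))) (at (snd e (p, q)))"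
      by (auto intro!: derivative_eq_intros)
  qed
  ultimately have A: "?A e = (fst (Z e), 0)"
    using tmap_has_derivative [OF _ e_def, of e] e_chart by simp
  have "?B = tmap (prod_manifold M N) (prod_manifold M N) (\<lambda>z. (p, snd z)) (p, q) Z"
    using tmap_compose [OF MN N diff_at_snd [OF M N p q], of "prod_manifold M N" "\<lambda>y. (p, y)"] in2 by simp
  moreover have "((snd e \<circ> (\<lambda>z. (p, snd z)) \<circ> chart_inv e) has_derivative (\<lambda>v. (0, snd v))) (at (snd e (p, q)))"
  proof (rule iffD2 [OF has_derivative_cong_nhds])
    show "\<forall>\<^sub>F x in nhds (snd e (p, q)). (snd e \<circ> (\<lambda>z. (p, snd z)) \<circ> chart_inv e) x = (snd c p, snd x)"
      using ev c_ev unfolding e snd_conv map_prod_simp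
      by eventually_elim (use chart_inv_chart [OF N charts_atD(1) [OF c(2)]] in auto)
    show "((\<lambda>x. (snd c p, snd x)) has_derivative (\<lambda>v. (0, snd v))) (at (snd e (p, q)))"
      by (auto intro!: derivative_eq_intros)
  qed
  ultimately have B: "?B e = (0, snd (Z e))"
    using tmap_has_derivative [OF _ e_def, of e] e_chart by simp
  show ?thesis
  proof (rule tspace_eqI [OF Z _ e_chart])
    show "tadd ?A ?B \<in> tspace (prod_manifold M N) (p, q)"
      using tmap_in_tspace [OF M MN in1] tmap_in_tspace [OF N MN in2] by (intro tadd_in_tspace MN)
    show "Z e = tadd ?A ?B e" by (simp add: tadd_def A B)
  qed
qed

text \<open>
  The differential of a map on a product is the sum of its partial differentials: apply \<open>tmap F\<close> to the
  two summands of \<open>tangent_prod_split\<close>.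
\<close>

lemma tmap_partials:
  assumes M: "differentiable_atlas M" and N: "differentiable_atlas N"
    and F: "diff_at (prod_manifold M N) R F (p, q)"
    and Z: "Z \<in> tspace (prod_manifold M N) (p, q)"
  shows "tmap (prod_manifold M N) R F (p, q) Z =
    tadd (tmap M R (\<lambda>x. F (x, q)) p (tmap (prod_manifold M N) M fst (p, q) Z))
      (tmap N R (\<lambda>y. F (p, y)) q (tmap (prod_manifold M N) N snd (p, q) Z))"
proof -
  note MN = differentiable_atlas_prod [OF M N]
  have p: "p \<in> mcarrier M" and q: "q \<in> mcarrier N" using diff_atD(1) [OF F] by simp_all
  have in1: "diff_at M (prod_manifold M N) (\<lambda>x. (x, q)) p"
    using M p q by (intro diff_at_Pair diff_at_id diff_at_const)
  have in2: "diff_at N (prod_manifold M N) (\<lambda>y. (p, y)) q"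
    using N p q by (intro diff_at_Pair diff_at_id diff_at_const)
  show ?thesis
    by (subst tangent_prod_split [OF M N p q Z])
      (simp only: tmap_tadd [OF F] tmap_compose [OF M MN in1 F] tmap_compose [OF N MN in2 F])
qed

text \<open>
  \<open>tangent_prod_split\<close> gives the uniqueness behind the definite description in \<open>tpair\<close>.
\<close>

lemma tpair_eq:
  assumes M: "differentiable_atlas M" and N: "differentiable_atlas N"
    and p: "p \<in> mcarrier M" and q: "q \<in> mcarrier N"
    and Z: "Z \<in> tspace (prod_manifold M N) (p, q)"
    and X: "tmap (prod_manifold M N) M fst (p, q) Z = X"
    and Y: "tmap (prod_manifold M N) N snd (p, q) Z = Y"
  shows "tpair M N p q X Y = Z"
  unfolding tpair_def
proof (rule the_equality)
  show "Z \<in> tspace (prod_manifold M N) (p, q) \<and>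
    tmap (prod_manifold M N) M fst (p, q) Z = X \<and> tmap (prod_manifold M N) N snd (p, q) Z = Y"
    using Z X Y by blast
  fix Z' assume "Z' \<in> tspace (prod_manifold M N) (p, q) \<and>
    tmap (prod_manifold M N) M fst (p, q) Z' = X \<and> tmap (prod_manifold M N) N snd (p, q) Z' = Y"
  then show "Z' = Z"
    using tangent_prod_split [OF M N p q Z] tangent_prod_split [OF M N p q, of Z'] X Y by simp
qed

text \<open>
  Existence: push \<open>X\<close> and \<open>Y\<close> forward along the two inclusions through \<open>(p, q)\<close> and add.
\<close>

lemma tpair:
  assumes M: "differentiable_atlas M" and N: "differentiable_atlas N"
    and p: "p \<in> mcarrier M" and q: "q \<in> mcarrier N"
    and X: "X \<in> tspace M p" and Y: "Y \<in> tspace N q"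
  shows "tpair M N p q X Y \<in> tspace (prod_manifold M N) (p, q)"
    and "tmap (prod_manifold M N) M fst (p, q) (tpair M N p q X Y) = X"
    and "tmap (prod_manifold M N) N snd (p, q) (tpair M N p q X Y) = Y"
proof -
  note MN = differentiable_atlas_prod [OF M N]
  have in1: "diff_at M (prod_manifold M N) (\<lambda>x. (x, q)) p"
    using M p q by (intro diff_at_Pair diff_at_id diff_at_const)
  have in2: "diff_at N (prod_manifold M N) (\<lambda>y. (p, y)) q"
    using N p q by (intro diff_at_Pair diff_at_id diff_at_const)
  define Z where "Z = tadd (tmap M (prod_manifold M N) (\<lambda>x. (x, q)) p X) (tmap N (prod_manifold M N) (\<lambda>y. (p, y)) q Y)"
  have Z: "Z \<in> tspace (prod_manifold M N) (p, q)"
    unfolding Z_def using tmap_in_tspace [OF M MN in1] tmap_in_tspace [OF N MN in2] by (intro tadd_in_tspace MN)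
  have f: "tmap (prod_manifold M N) M fst (p, q) Z = X"
    unfolding Z_def
    by (simp add: tmap_tadd [OF diff_at_fst [OF M N p q]] tmap_compose [OF M MN in1 diff_at_fst [OF M N p q]]
        tmap_compose [OF N MN in2 diff_at_fst [OF M N p q]] tmap_id [OF p X] tmap_const)
  have s: "tmap (prod_manifold M N) N snd (p, q) Z = Y"
    unfolding Z_def
    by (simp add: tmap_tadd [OF diff_at_snd [OF M N p q]] tmap_compose [OF M MN in1 diff_at_snd [OF M N p q]]
        tmap_compose [OF N MN in2 diff_at_snd [OF M N p q]] tmap_id [OF q Y] tmap_const)
  have "tpair M N p q X Y = Z" by (rule tpair_eq [OF M N p q Z f s])
  then show "tpair M N p q X Y \<in> tspace (prod_manifold M N) (p, q)"
    and "tmap (prod_manifold M N) M fst (p, q) (tpair M N p q X Y) = X"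
    and "tmap (prod_manifold M N) N snd (p, q) (tpair M N p q X Y) = Y"
    using Z f s by simp_all
qed

lemma tmap_Pair:
  assumes R: "differentiable_atlas R" and M: "differentiable_atlas M" and N: "differentiable_atlas N"
    and F: "diff_at R M F r" and H: "diff_at R N H r"
  shows "tmap R (prod_manifold M N) (\<lambda>x. (F x, H x)) r X = tpair M N (F r) (H r) (tmap R M F r X) (tmap R N H r X)"
proof (rule tpair_eq [OF M N diff_atD(2) [OF F] diff_atD(2) [OF H], symmetric])
  note FH = diff_at_Pair [OF F H] and MN = differentiable_atlas_prod [OF M N]
  show "tmap R (prod_manifold M N) (\<lambda>x. (F x, H x)) r X \<in> tspace (prod_manifold M N) (F r, H r)"
    by (rule tmap_in_tspace [OF R MN FH])
  show "tmap (prod_manifold M N) M fst (F r, H r) (tmap R (prod_manifold M N) (\<lambda>x. (F x, H x)) r X) = tmap R M F r X"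
    using tmap_compose [OF R MN FH diff_at_fst [OF M N diff_atD(2) [OF F] diff_atD(2) [OF H]]] by simp
  show "tmap (prod_manifold M N) N snd (F r, H r) (tmap R (prod_manifold M N) (\<lambda>x. (F x, H x)) r X) = tmap R N H r X"
    using tmap_compose [OF R MN FH diff_at_snd [OF M N diff_atD(2) [OF F] diff_atD(2) [OF H]]] by simp
qed

section \<open>Smooth maps and their restrictions to open sets\<close>

lemma smooth_on_differentiable: "smooth_on S f \<Longrightarrow> x \<in> S \<Longrightarrow> f differentiable (at x)"
  unfolding smooth_on_def by (metis Ck_on.simps(2))

lemma smooth_manifold_differentiable_atlas:
  assumes "smooth_manifold M"
  shows "differentiable_atlas M"
  using assms smooth_on_differentiable unfolding smooth_manifold_def differentiable_atlas_def by meson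

lemma charts_at_restrict:
  "c \<in> charts_at M p \<Longrightarrow> p \<in> W \<Longrightarrow> (fst c \<inter> W, snd c) \<in> charts_at (restrict_manifold M W) p"
  by (simp add: charts_at_def restrict_manifold_def)

lemma mcarrier_restrict: "mcarrier (restrict_manifold M W) = mcarrier M \<inter> W"
  unfolding mcarrier_def restrict_manifold_def image_image fst_conv by blast

lemma restrict_manifold_UNIV: "restrict_manifold M UNIV = M"
  by (simp add: restrict_manifold_def)

lemma mem_prod_manifold:
  "e \<in> prod_manifold M N \<longleftrightarrow> (\<exists>c\<in>M. \<exists>d\<in>N. e = (fst c \<times> fst d, map_prod (snd c) (snd d)))"
  unfolding prod_manifold_def by blast

lemma prod_restrict_manifold:
  fixes M :: "('a, 'b) atlas" and N :: "('c, 'd) atlas"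
  shows
  "prod_manifold (restrict_manifold M U) N = restrict_manifold (prod_manifold M N) (U \<times> UNIV)"
proof (rule Set.set_eqI)
  have eq: "((fst c \<inter> U) \<times> fst d, f) = ((fst c \<times> fst d) \<inter> (U \<times> UNIV), f)"
    for c :: "('a, 'b) chart" and d :: "('c, 'd) chart" and f :: "'a \<times> 'c \<Rightarrow> 'b \<times> 'd"
    by blast
  fix e
  have "e \<in> prod_manifold (restrict_manifold M U) N \<longleftrightarrow>
      (\<exists>c\<in>M. \<exists>d\<in>N. e = ((fst c \<inter> U) \<times> fst d, map_prod (snd c) (snd d)))"
    unfolding mem_prod_manifold restrict_manifold_def bex_simps fst_conv snd_conv ..
  also have "\<dots> \<longleftrightarrow> (\<exists>c\<in>M. \<exists>d\<in>N. e = ((fst c \<times> fst d) \<inter> (U \<times> UNIV), map_prod (snd c) (snd d)))"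
    unfolding eq ..
  also have "\<dots> \<longleftrightarrow> e \<in> restrict_manifold (prod_manifold M N) (U \<times> UNIV)"
  proof
    assume "\<exists>c\<in>M. \<exists>d\<in>N. e = ((fst c \<times> fst d) \<inter> (U \<times> UNIV), map_prod (snd c) (snd d))"
    then obtain c d where "c \<in> M" "d \<in> N"
      and e: "e = ((fst c \<times> fst d) \<inter> (U \<times> UNIV), map_prod (snd c) (snd d))"
      by (elim bexE)
    then have "(fst c \<times> fst d, map_prod (snd c) (snd d)) \<in> prod_manifold M N"
      unfolding mem_prod_manifold by blast
    from imageI [OF this, of "\<lambda>c. (fst c \<inter> (U \<times> UNIV), snd c)"]
    show "e \<in> restrict_manifold (prod_manifold M N) (U \<times> UNIV)"
      by (simp only: e restrict_manifold_def fst_conv snd_conv)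
  next
    assume "e \<in> restrict_manifold (prod_manifold M N) (U \<times> UNIV)"
    then obtain e' where "e' \<in> prod_manifold M N" and e: "e = (fst e' \<inter> (U \<times> UNIV), snd e')"
      unfolding restrict_manifold_def by (rule imageE)
    then obtain c d where "c \<in> M" "d \<in> N" "e' = (fst c \<times> fst d, map_prod (snd c) (snd d))"
      unfolding mem_prod_manifold by (elim bexE)
    then show "\<exists>c\<in>M. \<exists>d\<in>N. e = ((fst c \<times> fst d) \<inter> (U \<times> UNIV), map_prod (snd c) (snd d))"
      unfolding e by (intro bexI [of _ c] bexI [of _ d]) simp_all
  qed
  finally show "e \<in> prod_manifold (restrict_manifold M U) N \<longleftrightarrow>
      e \<in> restrict_manifold (prod_manifold M N) (U \<times> UNIV)" .
qed

text \<open>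
  Charts of a restricted manifold are restricted charts, with the same coordinates, so tangent maps
  never have to be taken between restricted manifolds. Bundle charts are used through this lemma.
\<close>

lemma smooth_map_restrict_diff_at:
  assumes M: "differentiable_atlas M" and N: "differentiable_atlas N"
    and F: "smooth_map (restrict_manifold M W) (restrict_manifold N V) F"
    and p: "p \<in> mcarrier M" "p \<in> W"
  shows "diff_at M N F p" and "near M p (\<lambda>x. x \<in> W)"
proof -
  have pW: "p \<in> mcarrier (restrict_manifold M W)" using p by (simp add: mcarrier_restrict)
  then have "F p \<in> mcarrier (restrict_manifold N V)" using F unfolding smooth_map_def by blast
  then have Fp: "F p \<in> mcarrier N" "F p \<in> V" by (simp_all add: mcarrier_restrict)
  have *: "(\<forall>\<^sub>F x in nhds (snd c p). chart_inv c x \<in> W \<and> F (chart_inv c x) \<in> fst d) \<and>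
      (snd d \<circ> F \<circ> chart_inv c) differentiable (at (snd c p))"
    if c: "c \<in> charts_at M p" and d: "d \<in> charts_at N (F p)" for c d
  proof -
    let ?c = "(fst c \<inter> W, snd c)" and ?d = "(fst d \<inter> V, snd d)"
    obtain W0 where W0: "open W0" "snd c p \<in> W0" "W0 \<subseteq> snd c ` (fst c \<inter> W)"
      "F ` chart_inv ?c ` W0 \<subseteq> fst d \<inter> V" "smooth_on W0 (snd d \<circ> F \<circ> chart_inv ?c)"
      using F [unfolded smooth_map_def, THEN conjunct2, rule_format, OF pW charts_at_restrict [OF c p(2)]
          charts_at_restrict [OF d Fp(2)]]
      unfolding fst_conv snd_conv by blast
    have inj: "inj_on (snd c) (fst c)" using M charts_atD(1) [OF c] by (simp add: differentiable_atlas_def)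
    have inv: "chart_inv ?c x = chart_inv c x \<and> chart_inv c x \<in> W" if x: "x \<in> W0" for x
    proof -
      obtain y where y: "y \<in> fst c \<inter> W" "x = snd c y" using W0(3) x by blast
      moreover have "inj_on (snd c) (fst c \<inter> W)" using inj by (rule inj_on_subset) blast
      ultimately show ?thesis using inj by (simp add: chart_inv_def)
    qed
    have ev: "\<forall>\<^sub>F x in nhds (snd c p). x \<in> W0" using W0(1,2) by (rule eventually_nhds_in_open)
    then have "\<forall>\<^sub>F x in nhds (snd c p). chart_inv c x \<in> W \<and> F (chart_inv c x) \<in> fst d"
    proof eventually_elim
      case (elim x)
      then show ?case using inv [OF elim] W0(4) by (metis IntD1 image_eqI subsetD)
    qed
    moreover have "\<forall>\<^sub>F x in nhds (snd c p). (snd d \<circ> F \<circ> chart_inv c) x = (snd d \<circ> F \<circ> chart_inv ?c) x"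
      using ev by eventually_elim (simp add: inv)
    then have "(snd d \<circ> F \<circ> chart_inv c) differentiable (at (snd c p))"
      using frechet_derivative_compose_ev(1) [OF differentiable_ident smooth_on_differentiable [OF W0(5,2)]] by blast
    ultimately show ?thesis by blast
  qed
  show "diff_at M N F p"
    unfolding diff_at_def near_def
    using p(1) Fp(1) * by (simp add: eventually_conj_iff)
  obtain d where "d \<in> charts_at N (F p)" using Fp(1) charts_at_nonempty by metis
  then show "near M p (\<lambda>x. x \<in> W)"
    unfolding near_def using * by (simp add: eventually_conj_iff)
qed

lemma smooth_map_diff_at:
  assumes "differentiable_atlas M" "differentiable_atlas N" "smooth_map M N F" "p \<in> mcarrier M"
  shows "diff_at M N F p"
  using smooth_map_restrict_diff_at(1) [of M N UNIV UNIV F p] assms by (simp add: restrict_manifold_UNIV)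

lemma differentiable_atlas_vspace: "differentiable_atlas vspace_manifold"
proof -
  have "chart_inv (UNIV, \<lambda>x::'a. x) = (\<lambda>x. x)"
    unfolding chart_inv_def by (intro ext inv_into_f_eq) simp_all
  then show ?thesis
    by (simp add: differentiable_atlas_def vspace_manifold_def comp_def)
qed

text \<open>
  \<open>(UNIV, \<lambda>x. x)\<close> is the chart of the vector space; reading a tangent map in it turns the chain
  rule and the partial differentials into statements about \<open>mdiff\<close>.
\<close>

lemma mdiff_eq_tmap:
  fixes M :: "('a, 'm::real_normed_vector) atlas" and f :: "'a \<Rightarrow> 'v::real_normed_vector"
  shows "mdiff M f p X = tmap M vspace_manifold f p X (UNIV, \<lambda>x. x)"
proof -
  have "(\<lambda>x. x) \<circ> f \<circ> g = f \<circ> g" for g :: "'m \<Rightarrow> 'a" by (simp add: fun_eq_iff)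
  moreover have "(UNIV, \<lambda>x. x) \<in> charts_at (vspace_manifold :: ('v, 'v) atlas) (f p)"
    by (simp add: charts_at_def vspace_manifold_def)
  ultimately show ?thesis by (simp add: mdiff_def tmap_def Let_def)
qed

section \<open>Group actions\<close>

text \<open>
  The part of the structure of a smooth action that first derivatives at single points see. It is
  inherited by subgroups with a manifold structure of their own as soon as the inclusion is
  differentiable.
\<close>

locale differentiable_action = group K for K :: "('g, 'z) monoid_scheme" (structure) +
  fixes AK :: "('g, 'h::real_normed_vector) atlas"
    and Q :: "('q, 'm::real_normed_vector) atlas"
    and l :: "'g \<Rightarrow> 'q \<Rightarrow> 'q"
  assumes atlas_K: "differentiable_atlas AK"
    and atlas_Q: "differentiable_atlas Q"
    and mcarrier_K: "mcarrier AK = carrier K"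
    and mult_diff_at: "g \<in> carrier K \<Longrightarrow> h \<in> carrier K \<Longrightarrow>
      diff_at (prod_manifold AK AK) AK (\<lambda>(g, h). g \<otimes> h) (g, h)"
    and act_diff_at: "g \<in> carrier K \<Longrightarrow> q \<in> mcarrier Q \<Longrightarrow>
      diff_at (prod_manifold AK Q) Q (\<lambda>(g, q). l g q) (g, q)"
    and act_one: "q \<in> mcarrier Q \<Longrightarrow> l \<one> q = q"
    and act_mult: "g \<in> carrier K \<Longrightarrow> h \<in> carrier K \<Longrightarrow> q \<in> mcarrier Q \<Longrightarrow> l (g \<otimes> h) q = l g (l h q)"
begin

lemma act_closed: "g \<in> carrier K \<Longrightarrow> q \<in> mcarrier Q \<Longrightarrow> l g q \<in> mcarrier Q"
  using diff_atD(2) [OF act_diff_at] by fastforce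

lemma act_inv: "g \<in> carrier K \<Longrightarrow> q \<in> mcarrier Q \<Longrightarrow> l (inv g) (l g q) = q"
  using act_mult [of "inv g" g q] by (simp add: act_one)

lemma translation_diff_at:
  assumes "g \<in> carrier K" "q \<in> mcarrier Q"
  shows "diff_at Q Q (l g) q"
proof -
  have "diff_at Q (prod_manifold AK Q) (\<lambda>q. (g, q)) q"
    using assms by (intro diff_at_Pair diff_at_const diff_at_id atlas_Q) (simp_all add: mcarrier_K)
  from diff_at_compose [OF atlas_Q differentiable_atlas_prod [OF atlas_K atlas_Q] this act_diff_at [OF assms]]
  show ?thesis by simp
qed

lemma orbit_map_diff_at:
  assumes "g \<in> carrier K" "q \<in> mcarrier Q"
  shows "diff_at AK Q (\<lambda>w. l w q) g"
proof -
  have "diff_at AK (prod_manifold AK Q) (\<lambda>w. (w, q)) g"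
    using assms by (intro diff_at_Pair diff_at_const diff_at_id atlas_K) (simp_all add: mcarrier_K)
  from diff_at_compose [OF atlas_K differentiable_atlas_prod [OF atlas_K atlas_Q] this act_diff_at [OF assms]]
  show ?thesis by simp
qed

lemma right_mult_diff_at:
  assumes "g \<in> carrier K" "h \<in> carrier K"
  shows "diff_at AK AK (\<lambda>w. w \<otimes> h) g"
proof -
  have "diff_at AK (prod_manifold AK AK) (\<lambda>w. (w, h)) g"
    using assms by (intro diff_at_Pair diff_at_const diff_at_id atlas_K) (simp_all add: mcarrier_K)
  from diff_at_compose [OF atlas_K differentiable_atlas_prod [OF atlas_K atlas_K] this mult_diff_at [OF assms]]
  show ?thesis by simp
qed

lemma left_mult_diff_at:
  assumes "g \<in> carrier K" "h \<in> carrier K"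
  shows "diff_at AK AK (\<lambda>w. h \<otimes> w) g"
proof -
  have "diff_at AK (prod_manifold AK AK) (\<lambda>w. (h, w)) g"
    using assms by (intro diff_at_Pair diff_at_const diff_at_id atlas_K) (simp_all add: mcarrier_K)
  from diff_at_compose [OF atlas_K differentiable_atlas_prod [OF atlas_K atlas_K] this mult_diff_at [OF assms(2,1)]]
  show ?thesis by simp
qed

lemma conjugation_diff_at:
  assumes "g \<in> carrier K" "h \<in> carrier K"
  shows "diff_at AK AK (\<lambda>w. g \<otimes> w \<otimes> inv g) h"
  using diff_at_compose [OF atlas_K atlas_K left_mult_diff_at [OF assms(2,1)] right_mult_diff_at] assms by simp

lemma Ad_in_lie_algebra:
  assumes "g \<in> carrier K"
  shows "Ad K AK g \<xi> \<in> lie_algebra K AK"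
  using tmap_in_tspace [OF atlas_K atlas_K conjugation_diff_at [OF assms one_closed]] assms
  by (simp add: Ad_def)

lemma inf_gen_in_tspace:
  assumes "q \<in> mcarrier Q"
  shows "inf_gen K AK Q l \<xi> q \<in> tspace Q q"
  using tmap_in_tspace [OF atlas_K atlas_Q orbit_map_diff_at [OF one_closed assms]]
  by (simp add: inf_gen_def act_one assms)

text \<open>
  Differentiate \<open>w \<cdot> (g \<cdot> q) = g \<cdot> ((g\<^sup>-\<^sup>1 w g) \<cdot> q)\<close> at \<open>w = e\<close>.
\<close>

lemma inf_gen_translate:
  assumes g: "g \<in> carrier K" and q: "q \<in> mcarrier Q"
  shows "inf_gen K AK Q l \<xi> (l g q) = tmap Q Q (l g) q (inf_gen K AK Q l (Ad K AK (inv g) \<xi>) q)"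
proof -
  have c: "diff_at AK AK (\<lambda>w. inv g \<otimes> w \<otimes> g) \<one>"
    using conjugation_diff_at [of "inv g" \<one>] g by simp
  have c1: "inv g \<otimes> \<one> \<otimes> g = \<one>" using g by simp
  have o: "diff_at AK Q (\<lambda>w. l w q) (inv g \<otimes> \<one> \<otimes> g)"
    unfolding c1 by (rule orbit_map_diff_at [OF one_closed q])
  have co: "diff_at AK Q (\<lambda>w. l (inv g \<otimes> w \<otimes> g) q) \<one>"
    using diff_at_compose [OF atlas_K atlas_K c o] .
  have t: "diff_at Q Q (l g) (l (inv g \<otimes> \<one> \<otimes> g) q)"
    unfolding c1 act_one [OF q] by (rule translation_diff_at [OF g q])
  have "tmap Q Q (l g) q (inf_gen K AK Q l (Ad K AK (inv g) \<xi>) q) =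
      tmap Q Q (l g) (l (inv g \<otimes> \<one> \<otimes> g) q) (tmap AK Q (\<lambda>w. l w q) (inv g \<otimes> \<one> \<otimes> g)
        (tmap AK AK (\<lambda>w. inv g \<otimes> w \<otimes> g) \<one> \<xi>))"
    using g by (simp add: inf_gen_def Ad_def c1 act_one [OF q])
  also have "\<dots> = tmap AK Q (\<lambda>w. l g (l (inv g \<otimes> w \<otimes> g) q)) \<one> \<xi>"
    unfolding tmap_compose [OF atlas_K atlas_K c o] tmap_compose [OF atlas_K atlas_Q co t] ..
  also have "\<dots> = tmap AK Q (\<lambda>w. l w (l g q)) \<one> \<xi>"
  proof (rule tmap_cong [OF atlas_K _ near_mcarrier [OF atlas_K]])
    fix w assume "w \<in> mcarrier AK"
    then have w: "w \<in> carrier K" by (simp add: mcarrier_K)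
    have "l g (l (inv g \<otimes> w \<otimes> g) q) = l (g \<otimes> (inv g \<otimes> w \<otimes> g)) q"
      using g w q by (simp add: act_mult)
    also have "g \<otimes> (inv g \<otimes> w \<otimes> g) = w \<otimes> g"
      using g w by (simp add: m_assoc [symmetric])
    also have "l (w \<otimes> g) q = l w (l g q)" using g w q by (simp add: act_mult)
    finally show "l g (l (inv g \<otimes> w \<otimes> g) q) = l w (l g q)" .
  qed (simp add: mcarrier_K)
  finally show ?thesis by (simp add: inf_gen_def)
qed

lemma orbit_refl: "q \<in> mcarrier Q \<Longrightarrow> q \<in> orbit K l q"
  unfolding orbit_def using act_one by force

lemma orbit_translate:
  assumes g: "g \<in> carrier K" and q: "q \<in> mcarrier Q"
  shows "orbit K l (l g q) = orbit K l q"
proof -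
  have "(\<lambda>h. h \<otimes> g) ` carrier K = carrier K"
  proof
    show "carrier K \<subseteq> (\<lambda>h. h \<otimes> g) ` carrier K"
    proof
      fix h assume "h \<in> carrier K"
      then show "h \<in> (\<lambda>h. h \<otimes> g) ` carrier K"
        using g by (intro image_eqI [of _ _ "h \<otimes> inv g"]) (simp_all add: m_assoc)
    qed
  qed (use g in auto)
  then have "orbit K l q = (\<lambda>h. l (h \<otimes> g) q) ` carrier K"
    unfolding orbit_def using image_image [of "\<lambda>h. l h q" "\<lambda>h. h \<otimes> g" "carrier K"] by simp
  also have "\<dots> = orbit K l (l g q)"
    unfolding orbit_def using g q by (intro image_cong) (simp_all add: act_mult)
  finally show ?thesis ..
qed

end

section \<open>Principal bundles and horizontal lifts\<close>

locale principal_bundle = differentiable_action K AK Q l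
  for K :: "('g, 'z) monoid_scheme" (structure)
    and AK :: "('g, 'h::real_normed_vector) atlas"
    and Q :: "('q, 'm::real_normed_vector) atlas"
    and l :: "'g \<Rightarrow> 'q \<Rightarrow> 'q" +
  fixes B :: "('q set, 'b::real_normed_vector) atlas"
    and \<AA> :: "'q \<Rightarrow> ('q, 'm) tvec \<Rightarrow> ('g, 'h) tvec"
  assumes quotient_bundle: "quotient_principal_bundle K AK Q l B"
    and connection: "principal_connection K AK Q l \<AA>"
begin

lemma atlas_B: "differentiable_atlas B"
  using quotient_bundle unfolding quotient_principal_bundle_def
  by (intro smooth_manifold_differentiable_atlas) (elim conjE)

lemma orbit_diff_at: "q \<in> mcarrier Q \<Longrightarrow> diff_at Q B (orbit K l) q"
  using quotient_bundle unfolding quotient_principal_bundle_def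
  by (intro smooth_map_diff_at [OF atlas_Q atlas_B]) (elim conjE)

lemma mcarrier_B: "mcarrier B = orbit K l ` mcarrier Q"
  using quotient_bundle unfolding quotient_principal_bundle_def by blast

text \<open>
  \<open>\<Psi>\<close> is a bundle chart around \<open>q\<close>, \<open>\<Phi>\<close> its inverse and \<open>h\<close> the group coordinate of \<open>q\<close>. Besides
  equivariance along the fibre of \<open>q\<close>, only the germs at corresponding points are constrained, which is
  what tangent maps see.
\<close>

definition trivialises ::
  "'q \<Rightarrow> ('q set \<times> 'g \<Rightarrow> 'q) \<Rightarrow> ('q \<Rightarrow> 'q set \<times> 'g) \<Rightarrow> 'g \<Rightarrow> bool" where
  "trivialises q \<Psi> \<Phi> h \<longleftrightarrow>
     h \<in> carrier K \<and> \<Psi> (orbit K l q, h) = q \<and> \<Phi> q = (orbit K l q, h) \<and>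
     diff_at (prod_manifold B AK) Q \<Psi> (orbit K l q, h) \<and> diff_at Q (prod_manifold B AK) \<Phi> q \<and>
     near (prod_manifold B AK) (orbit K l q, h) (\<lambda>z. orbit K l (\<Psi> z) = fst z) \<and>
     near Q q (\<lambda>x. \<Psi> (\<Phi> x) = x \<and> fst (\<Phi> x) = orbit K l x) \<and>
     (\<forall>w\<in>carrier K. \<Psi> (orbit K l q, w \<otimes> h) = l w q)"

lemma trivialisesD:
  assumes "trivialises q \<Psi> \<Phi> h"
  shows "h \<in> carrier K" "\<Psi> (orbit K l q, h) = q" "\<Phi> q = (orbit K l q, h)"
    "diff_at (prod_manifold B AK) Q \<Psi> (orbit K l q, h)" "diff_at Q (prod_manifold B AK) \<Phi> q"
    "near (prod_manifold B AK) (orbit K l q, h) (\<lambda>z. orbit K l (\<Psi> z) = fst z)"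
    "near Q q (\<lambda>x. \<Psi> (\<Phi> x) = x \<and> fst (\<Phi> x) = orbit K l x)"
    "w \<in> carrier K \<Longrightarrow> \<Psi> (orbit K l q, w \<otimes> h) = l w q"
  using assms by (simp_all add: trivialises_def)

lemma local_trivialisation:
  assumes q: "q \<in> mcarrier Q"
  shows "\<exists>\<Psi> \<Phi> h. trivialises q \<Psi> \<Phi> h"
proof -
  have "orbit K l q \<in> mcarrier B" using q mcarrier_B by blast
  then obtain U \<Psi> where U: "orbit K l q \<in> U"
    and diffeo: "diffeo (prod_manifold (restrict_manifold B U) AK)
      (restrict_manifold Q {q \<in> mcarrier Q. orbit K l q \<in> U}) \<Psi>"
    and \<Psi>: "\<And>\<sigma> h. \<sigma> \<in> U \<Longrightarrow> h \<in> carrier K \<Longrightarrow> orbit K l (\<Psi> (\<sigma>, h)) = \<sigma> \<and>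
      (\<forall>g\<in>carrier K. \<Psi> (\<sigma>, g \<otimes> h) = l g (\<Psi> (\<sigma>, h)))"
    using quotient_bundle unfolding quotient_principal_bundle_def by meson
  define V where "V = {q \<in> mcarrier Q. orbit K l q \<in> U}"
  define P where "P = restrict_manifold (prod_manifold B AK) (U \<times> UNIV)"
  define \<Phi> where "\<Phi> = inv_into (mcarrier P) \<Psi>"
  have P: "mcarrier P = (mcarrier B \<inter> U) \<times> carrier K"
    unfolding P_def mcarrier_restrict mcarrier_prod mcarrier_K by blast
  have V: "mcarrier (restrict_manifold Q V) = V"
    unfolding mcarrier_restrict V_def by blast
  have bij: "bij_betw \<Psi> (mcarrier P) V" and s: "smooth_map P (restrict_manifold Q V) \<Psi>"
    and si: "smooth_map (restrict_manifold Q V) P \<Phi>"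
    using diffeo unfolding diffeo_def prod_restrict_manifold P_def [symmetric] V_def [symmetric] V \<Phi>_def
    by blast+
  have \<Phi>P: "\<Phi> x \<in> mcarrier P" and \<Psi>\<Phi>: "\<Psi> (\<Phi> x) = x" if "x \<in> V" for x
    using bij that unfolding bij_betw_def \<Phi>_def by (blast intro: inv_into_into f_inv_into_f)+
  have fst\<Phi>: "fst (\<Phi> x) = orbit K l x" if "x \<in> V" for x
    using \<Psi> [of "fst (\<Phi> x)" "snd (\<Phi> x)"] \<Phi>P [OF that] \<Psi>\<Phi> [OF that] unfolding P by (cases "\<Phi> x") auto
  have qV: "q \<in> V" using q U by (simp add: V_def)
  define h where "h = snd (\<Phi> q)"
  have \<Phi>q: "\<Phi> q = (orbit K l q, h)" using fst\<Phi> [OF qV] by (simp add: h_def prod_eq_iff)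
  have h: "h \<in> carrier K" and B: "orbit K l q \<in> mcarrier B"
    using \<Phi>P [OF qV] unfolding P \<Phi>q by auto
  have \<Psi>q: "\<Psi> (orbit K l q, h) = q" using \<Psi>\<Phi> [OF qV] \<Phi>q by simp
  note BK = differentiable_atlas_prod [OF atlas_B atlas_K]
  have z: "(orbit K l q, h) \<in> mcarrier (prod_manifold B AK)" "(orbit K l q, h) \<in> U \<times> UNIV"
    using B h U by (simp_all add: mcarrier_K)
  have "trivialises q \<Psi> \<Phi> h"
    unfolding trivialises_def
  proof (intro conjI ballI)
    show "h \<in> carrier K" "\<Psi> (orbit K l q, h) = q" "\<Phi> q = (orbit K l q, h)"
      by (rule h \<Psi>q \<Phi>q)+
    show "diff_at (prod_manifold B AK) Q \<Psi> (orbit K l q, h)"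
      using smooth_map_restrict_diff_at(1) [OF BK atlas_Q s [unfolded P_def] z] .
    show "diff_at Q (prod_manifold B AK) \<Phi> q"
      using smooth_map_restrict_diff_at(1) [OF atlas_Q BK si [unfolded P_def] q qV] .
    show "near (prod_manifold B AK) (orbit K l q, h) (\<lambda>z. orbit K l (\<Psi> z) = fst z)"
    proof (rule near_mono)
      have "near (prod_manifold B AK) (orbit K l q, h) (\<lambda>z. z \<in> mcarrier (prod_manifold B AK))"
        by (rule near_mcarrier [OF BK])
      with smooth_map_restrict_diff_at(2) [OF BK atlas_Q s [unfolded P_def] z]
      show "near (prod_manifold B AK) (orbit K l q, h)
          (\<lambda>z. z \<in> U \<times> UNIV \<and> z \<in> mcarrier (prod_manifold B AK))"
        by (rule near_conj)
      show "orbit K l (\<Psi> z) = fst z" if "z \<in> U \<times> UNIV \<and> z \<in> mcarrier (prod_manifold B AK)" for z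
        using \<Psi> that by (auto simp: mcarrier_K)
    qed
    show "near Q q (\<lambda>x. \<Psi> (\<Phi> x) = x \<and> fst (\<Phi> x) = orbit K l x)"
      using smooth_map_restrict_diff_at(2) [OF atlas_Q BK si [unfolded P_def] q qV]
      by (rule near_mono) (use \<Psi>\<Phi> fst\<Phi> in blast)
    show "\<Psi> (orbit K l q, w \<otimes> h) = l w q" if "w \<in> carrier K" for w
      using \<Psi> [OF U h] that \<Psi>q by simp
  qed
  then show ?thesis by blast
qed

text \<open>
  In a bundle chart the quotient map is the projection \<open>fst\<close>, so \<open>(\<delta>, 0)\<close> is a preimage of \<open>\<delta>\<close>.
\<close>

lemma tmap_orbit_surj:
  assumes q: "q \<in> mcarrier Q" and \<delta>: "\<delta> \<in> tspace B (orbit K l q)"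
  obtains X where "X \<in> tspace Q q" "tmap Q B (orbit K l) q X = \<delta>"
proof -
  obtain \<Psi> \<Phi> h where triv: "trivialises q \<Psi> \<Phi> h"
    using local_trivialisation [OF q] by (elim exE)
  note h = trivialisesD(1) [OF triv] and \<Psi>q = trivialisesD(2) [OF triv] and \<Phi>q = trivialisesD(3) [OF triv]
    and \<Psi> = trivialisesD(4) [OF triv] and \<Phi> = trivialisesD(5) [OF triv]
    and near1 = trivialisesD(6) [OF triv] and near2 = trivialisesD(7) [OF triv]
    and equivariant = trivialisesD(8) [OF triv]
  note BK = differentiable_atlas_prod [OF atlas_B atlas_K]
  have B: "orbit K l q \<in> mcarrier B" and h': "h \<in> mcarrier AK" using q h mcarrier_B mcarrier_K by blast+
  define Z where "Z = tpair B AK (orbit K l q) h \<delta> tzero"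
  have Z: "tmap (prod_manifold B AK) B fst (orbit K l q, h) Z = \<delta>"
    unfolding Z_def by (rule tpair(2) [OF atlas_B atlas_K B h' \<delta> tzero_in_tspace [OF atlas_K]])
  have o: "diff_at Q B (orbit K l) (\<Psi> (orbit K l q, h))" unfolding \<Psi>q by (rule orbit_diff_at [OF q])
  show thesis
  proof (rule that)
    show "tmap (prod_manifold B AK) Q \<Psi> (orbit K l q, h) Z \<in> tspace Q q"
      using tmap_in_tspace [OF BK atlas_Q \<Psi>] by (simp add: \<Psi>q)
    show "tmap Q B (orbit K l) q (tmap (prod_manifold B AK) Q \<Psi> (orbit K l q, h) Z) = \<delta>"
      using tmap_compose [OF BK atlas_Q \<Psi> o, of Z] Z
        tmap_cong [OF BK _ near1, of B Z] B h' by (simp add: \<Psi>q)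
  qed
qed

text \<open>
  The kernel of the tangent map of the quotient map is vertical: in a bundle chart such a vector is
  \<open>(0, \<eta>)\<close> with \<open>\<eta>\<close> tangent to the group at \<open>h\<close>. Right translation by \<open>h\<close> takes some \<open>\<xi>\<close> in the Lie
  algebra to \<open>\<eta>\<close>, and the equivariance of the chart turns \<open>(0, \<eta>)\<close> into the generator of \<open>\<xi>\<close>.
\<close>

lemma tmap_orbit_kernel:
  assumes q: "q \<in> mcarrier Q" and Y: "Y \<in> tspace Q q" and 0: "tmap Q B (orbit K l) q Y = tzero"
  obtains \<xi> where "\<xi> \<in> lie_algebra K AK" "Y = inf_gen K AK Q l \<xi> q"
proof -
  obtain \<Psi> \<Phi> h where triv: "trivialises q \<Psi> \<Phi> h"
    using local_trivialisation [OF q] by (elim exE)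
  note h = trivialisesD(1) [OF triv] and \<Psi>q = trivialisesD(2) [OF triv] and \<Phi>q = trivialisesD(3) [OF triv]
    and \<Psi> = trivialisesD(4) [OF triv] and \<Phi> = trivialisesD(5) [OF triv]
    and near1 = trivialisesD(6) [OF triv] and near2 = trivialisesD(7) [OF triv]
    and equivariant = trivialisesD(8) [OF triv]
  note BK = differentiable_atlas_prod [OF atlas_B atlas_K]
  have B: "orbit K l q \<in> mcarrier B" and h': "h \<in> mcarrier AK" using q h mcarrier_B mcarrier_K by blast+
  define Z where "Z = tmap Q (prod_manifold B AK) \<Phi> q Y"
  have Z: "Z \<in> tspace (prod_manifold B AK) (orbit K l q, h)"
    unfolding Z_def using tmap_in_tspace [OF atlas_Q BK \<Phi>] by (simp add: \<Phi>q)
  have "tmap (prod_manifold B AK) B fst (\<Phi> q) Z = tmap Q B (\<lambda>x. fst (\<Phi> x)) q Y"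
    unfolding Z_def by (rule tmap_compose [OF atlas_Q BK \<Phi>]) (simp add: \<Phi>q diff_at_fst [OF atlas_B atlas_K B h'])
  also have "\<dots> = tmap Q B (orbit K l) q Y"
    by (rule tmap_cong [OF atlas_Q q]) (rule near_mono [OF near2], blast)
  finally have fstZ: "tmap (prod_manifold B AK) B fst (orbit K l q, h) Z = tzero"
    by (simp add: \<Phi>q 0)
  define \<eta> where "\<eta> = tmap (prod_manifold B AK) AK snd (orbit K l q, h) Z"
  define \<xi> where "\<xi> = tmap AK AK (\<lambda>w. w \<otimes> inv h) h \<eta>"
  have R: "diff_at AK AK (\<lambda>w. w \<otimes> inv h) h" using h by (intro right_mult_diff_at) simp_all
  have o: "diff_at AK Q (\<lambda>w. l w q) (h \<otimes> inv h)" using h q by (simp add: orbit_map_diff_at)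
  have "diff_at B (prod_manifold B AK) (\<lambda>x. (x, h)) (orbit K l q)"
    using B h' by (intro diff_at_Pair diff_at_id diff_at_const atlas_B)
  from diff_at_compose [OF atlas_B BK this \<Psi>]
  have \<Psi>1: "diff_at B Q (\<lambda>x. \<Psi> (x, h)) (orbit K l q)" .
  have "Y = tmap Q Q (\<lambda>x. \<Psi> (\<Phi> x)) q Y"
    using tmap_cong [OF atlas_Q q, of "\<lambda>x. \<Psi> (\<Phi> x)" "\<lambda>x. x" Q Y] near_mono [OF near2]
      tmap_id [OF q Y] by simp
  also have "\<dots> = tmap (prod_manifold B AK) Q \<Psi> (orbit K l q, h) Z"
    using tmap_compose [OF atlas_Q BK \<Phi>, of Q \<Psi> Y] \<Psi> by (simp add: Z_def \<Phi>q)
  also have "\<dots> = tmap AK Q (\<lambda>w. \<Psi> (orbit K l q, w)) h \<eta>"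
    by (simp add: tmap_partials [OF atlas_B atlas_K \<Psi> Z] fstZ tmap_tzero [OF \<Psi>1] \<eta>_def)
  also have "\<dots> = tmap AK Q (\<lambda>w. l (w \<otimes> inv h) q) h \<eta>"
  proof (rule tmap_cong [OF atlas_K h' near_mcarrier [OF atlas_K]])
    fix w assume "w \<in> mcarrier AK"
    then show "\<Psi> (orbit K l q, w) = l (w \<otimes> inv h) q"
      using equivariant [of "w \<otimes> inv h"] h by (simp add: mcarrier_K m_assoc)
  qed
  also have "\<dots> = inf_gen K AK Q l \<xi> q"
    using tmap_compose [OF atlas_K atlas_K R o, of \<eta>] h by (simp add: inf_gen_def \<xi>_def)
  finally have "Y = inf_gen K AK Q l \<xi> q" .
  moreover have "\<xi> \<in> lie_algebra K AK"
    using tmap_in_tspace [OF atlas_K atlas_K R] h by (simp add: \<xi>_def)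
  ultimately show thesis by (rule that [rotated])
qed

lemma connection_tadd:
  "q \<in> mcarrier Q \<Longrightarrow> X \<in> tspace Q q \<Longrightarrow> Y \<in> tspace Q q \<Longrightarrow> \<AA> q (tadd X Y) = tadd (\<AA> q X) (\<AA> q Y)"
  using connection unfolding principal_connection_def by blast

lemma connection_tscale:
  "q \<in> mcarrier Q \<Longrightarrow> X \<in> tspace Q q \<Longrightarrow> \<AA> q (tscale r X) = tscale r (\<AA> q X)"
  using connection unfolding principal_connection_def by blast

lemma connection_inf_gen:
  "q \<in> mcarrier Q \<Longrightarrow> \<xi> \<in> lie_algebra K AK \<Longrightarrow> \<AA> q (inf_gen K AK Q l \<xi> q) = \<xi>"
  using connection unfolding principal_connection_def by blast

lemma connection_equivariant:
  "q \<in> mcarrier Q \<Longrightarrow> g \<in> carrier K \<Longrightarrow> X \<in> tspace Q q \<Longrightarrow>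
    \<AA> (l g q) (tmap Q Q (l g) q X) = Ad K AK g (\<AA> q X)"
  using connection unfolding principal_connection_def by blast

text \<open>
  Contained in the smoothness of the connection form as a map into \<open>tspace_manifold\<close>.
\<close>

lemma connection_in_lie_algebra:
  assumes q: "q \<in> mcarrier Q" and X: "X \<in> tspace Q q"
  shows "\<AA> q X \<in> lie_algebra K AK"
proof -
  obtain c where c: "c \<in> charts_at Q q" using q charts_at_nonempty by metis
  have "({(p, X). p \<in> fst c \<and> X \<in> tspace Q p}, \<lambda>(p, X). (snd c p, X c)) \<in> tangent_bundle Q"
    unfolding tangent_bundle_def using charts_atD(1) [OF c] by blast
  then have "(q, X) \<in> mcarrier (tangent_bundle Q)"
    unfolding mcarrier_def using charts_atD(2) [OF c] X by force
  then have "\<AA> q X \<in> mcarrier (tspace_manifold AK \<one>)"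
    using connection unfolding principal_connection_def smooth_map_def by blast
  also have "mcarrier (tspace_manifold AK \<one>) \<subseteq> lie_algebra K AK"
    unfolding mcarrier_def tspace_manifold_def by auto
  finally show ?thesis .
qed

text \<open>
  Existence: subtract from any preimage of \<open>\<delta>\<close> its vertical part, the generator of the value of the
  connection. Uniqueness: the difference of two lifts is vertical, and a vertical vector is
  determined by the value of the connection on it.
\<close>

lemma ex1_horizontal_lift:
  assumes q: "q \<in> mcarrier Q" and \<delta>: "\<delta> \<in> tspace B (orbit K l q)"
  shows "\<exists>!X. X \<in> tspace Q q \<and> \<AA> q X = tzero \<and> tmap Q B (orbit K l) q X = \<delta>"
proof -
  let ?T = "tmap Q B (orbit K l) q"
  note T_add = tmap_tadd [OF orbit_diff_at [OF q]] and T_scale = tmap_tscale [OF orbit_diff_at [OF q]]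
  obtain X where X: "X \<in> tspace Q q" "?T X = \<delta>" using tmap_orbit_surj [OF q \<delta>] .
  define \<xi> where "\<xi> = \<AA> q X"
  define V where "V = inf_gen K AK Q l \<xi> q"
  have \<xi>: "\<xi> \<in> lie_algebra K AK" unfolding \<xi>_def by (rule connection_in_lie_algebra [OF q X(1)])
  have V: "V \<in> tspace Q q" unfolding V_def by (rule inf_gen_in_tspace [OF q])
  have "?T V = tmap Q B (orbit K l) (l \<one> q) (tmap AK Q (\<lambda>w. l w q) \<one> \<xi>)"
    by (simp add: V_def inf_gen_def act_one q)
  also have "\<dots> = tmap AK B (\<lambda>w. orbit K l (l w q)) \<one> \<xi>"
    using q by (intro tmap_compose atlas_K atlas_Q orbit_map_diff_at orbit_diff_at) (simp_all add: act_one)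
  also have "\<dots> = tmap AK B (\<lambda>w. orbit K l q) \<one> \<xi>"
    using q by (intro tmap_cong atlas_K near_mcarrier) (simp_all add: mcarrier_K orbit_translate)
  finally have TV: "?T V = tzero" by (simp add: tmap_const)
  \<comment> \<open>The horizontal part of \<open>X\<close>: \<open>V\<close> is its vertical part.\<close>
  define H where "H = tadd X (tscale (-1) V)"
  have sV: "tscale (-1) V \<in> tspace Q q" by (rule tscale_in_tspace [OF atlas_Q V])
  have H: "H \<in> tspace Q q" unfolding H_def by (rule tadd_in_tspace [OF atlas_Q X(1) sV])
  have "\<AA> q V = \<xi>" unfolding V_def by (rule connection_inf_gen [OF q \<xi>])
  then have "\<AA> q H = tzero"
    unfolding H_def connection_tadd [OF q X(1) sV] connection_tscale [OF q V]
    by (simp add: \<xi>_def tadd_def tscale_def tzero_def)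
  moreover have "?T H = \<delta>"
    unfolding H_def T_add T_scale TV X(2) by (simp add: tadd_def tscale_def tzero_def)
  ultimately have ex: "H \<in> tspace Q q \<and> \<AA> q H = tzero \<and> ?T H = \<delta>" using H by blast
  show ?thesis
  proof (rule ex1I [of _ H])
    show "H \<in> tspace Q q \<and> \<AA> q H = tzero \<and> ?T H = \<delta>" by (rule ex)
    fix X' assume X': "X' \<in> tspace Q q \<and> \<AA> q X' = tzero \<and> ?T X' = \<delta>"
    define Y where "Y = tadd X' (tscale (-1) H)"
    have sH: "tscale (-1) H \<in> tspace Q q" by (rule tscale_in_tspace [OF atlas_Q H])
    have Y: "Y \<in> tspace Q q" unfolding Y_def using X' by (intro tadd_in_tspace [OF atlas_Q _ sH]) blast
    have "?T Y = tzero"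
      unfolding Y_def T_add T_scale using X' ex by (simp add: tadd_def tscale_def tzero_def)
    then obtain \<zeta> where \<zeta>: "\<zeta> \<in> lie_algebra K AK" "Y = inf_gen K AK Q l \<zeta> q"
      using tmap_orbit_kernel [OF q Y] by blast
    have "\<AA> q Y = tadd (\<AA> q X') (tscale (-1) (\<AA> q H))"
      unfolding Y_def using X' by (simp only: connection_tadd [OF q _ sH] connection_tscale [OF q H])
    also have "\<dots> = tzero"
      using X' ex by (simp only:) (simp add: tadd_def tscale_def tzero_def)
    finally have "\<AA> q Y = tzero" .
    then have "\<zeta> = tzero" using connection_inf_gen [OF q \<zeta>(1)] \<zeta>(2) by simp
    then have "Y = tzero"
      using tmap_tzero [OF orbit_map_diff_at [OF one_closed q]] \<zeta>(2) by (simp add: inf_gen_def)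
    then show "X' = H" by (simp add: Y_def tadd_def tscale_def tzero_def fun_eq_iff)
  qed
qed

lemma horizontal_lift:
  assumes "q \<in> mcarrier Q" "\<delta> \<in> tspace B (orbit K l q)"
  shows "horizontal_lift K Q l B \<AA> q \<delta> \<in> tspace Q q"
    and "\<AA> q (horizontal_lift K Q l B \<AA> q \<delta>) = tzero"
    and "tmap Q B (orbit K l) q (horizontal_lift K Q l B \<AA> q \<delta>) = \<delta>"
  using theI' [OF ex1_horizontal_lift [OF assms]] unfolding horizontal_lift_def by blast+

text \<open>
  Translation preserves horizontality by equivariance of the connection and preserves the
  projection to the base, so the claim follows by uniqueness of horizontal lifts.
\<close>

lemma horizontal_lift_translate:
  assumes q: "q \<in> mcarrier Q" and \<delta>: "\<delta> \<in> tspace B (orbit K l q)" and g: "g \<in> carrier K"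
  shows "horizontal_lift K Q l B \<AA> (l g q) \<delta> = tmap Q Q (l g) q (horizontal_lift K Q l B \<AA> q \<delta>)"
    (is "_ = tmap Q Q (l g) q ?X")
proof -
  note X = horizontal_lift [OF q \<delta>]
  note gq = act_closed [OF g q] and lg = translation_diff_at [OF g q]
  have \<delta>': "\<delta> \<in> tspace B (orbit K l (l g q))" using \<delta> by (simp add: orbit_translate g q)
  have "\<AA> (l g q) (tmap Q Q (l g) q ?X) = Ad K AK g tzero"
    by (simp add: connection_equivariant [OF q g X(1)] X(2))
  also have "\<dots> = tzero"
    unfolding Ad_def by (rule tmap_tzero [OF conjugation_diff_at [OF g one_closed]])
  finally have 1: "\<AA> (l g q) (tmap Q Q (l g) q ?X) = tzero" .
  have "tmap Q B (orbit K l) (l g q) (tmap Q Q (l g) q ?X) = tmap Q B (\<lambda>x. orbit K l (l g x)) q ?X"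
    by (rule tmap_compose [OF atlas_Q atlas_Q lg orbit_diff_at [OF gq]])
  also have "\<dots> = tmap Q B (orbit K l) q ?X"
    using q by (intro tmap_cong atlas_Q near_mcarrier) (simp_all add: orbit_translate g)
  finally have 2: "tmap Q B (orbit K l) (l g q) (tmap Q Q (l g) q ?X) = \<delta>" by (simp add: X(3))
  show ?thesis
    unfolding horizontal_lift_def [of K Q l B \<AA> "l g q"]
    using ex1_horizontal_lift [OF gq \<delta>'] 1 2 tmap_in_tspace [OF atlas_Q atlas_Q lg]
    by (intro the1_equality) blast+
qed

end

section \<open>The momentum map and the affine discrete connection\<close>

text \<open>
  The value \<open>\<nu>\<close> is fixed by the coadjoint action of the whole group, which makes the level set of the
  momentum map, and with it the discrete connection and the discrete lift, equivariant.
\<close>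

locale invariant_lagrangian_level = differentiable_action K AK Q l
  for K :: "('g, 'z) monoid_scheme" (structure)
    and AK :: "('g, 'h::real_normed_vector) atlas"
    and Q :: "('q, 'm::real_normed_vector) atlas"
    and l :: "'g \<Rightarrow> 'q \<Rightarrow> 'q" +
  fixes L :: "'q \<times> 'q \<Rightarrow> real"
    and \<nu> :: "('g, 'h) tvec \<Rightarrow> real"
  assumes L_diff_at: "q0 \<in> mcarrier Q \<Longrightarrow> q1 \<in> mcarrier Q \<Longrightarrow>
      diff_at (prod_manifold Q Q) vspace_manifold L (q0, q1)"
    and L_invariant: "g \<in> carrier K \<Longrightarrow> q0 \<in> mcarrier Q \<Longrightarrow> q1 \<in> mcarrier Q \<Longrightarrow>
      L (l g q0, l g q1) = L (q0, q1)"
    and level_extensional: "\<nu> \<in> extensional (lie_algebra K AK)"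
    and level_Ad: "g \<in> carrier K \<Longrightarrow> \<xi> \<in> lie_algebra K AK \<Longrightarrow> \<nu> (Ad K AK g \<xi>) = \<nu> \<xi>"
    and ex1_connection: "q0 \<in> mcarrier Q \<Longrightarrow> q1 \<in> mcarrier Q \<Longrightarrow>
      \<exists>!g. g \<in> carrier K \<and> momentum_map K AK Q l L q0 (l (inv g) q1) = \<nu>"
begin

abbreviation J where "J \<equiv> momentum_map K AK Q l L"
abbreviation \<A> where "\<A> \<equiv> discrete_connection K AK Q l L \<nu>"
abbreviation lift where "lift \<equiv> discrete_lift K AK Q l L \<nu>"

lemma L_left_diff_at:
  assumes "q0 \<in> mcarrier Q" "q1 \<in> mcarrier Q"
  shows "diff_at Q vspace_manifold (\<lambda>q. L (q, q1)) q0"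
proof -
  have "diff_at Q (prod_manifold Q Q) (\<lambda>q. (q, q1)) q0"
    using assms by (intro diff_at_Pair diff_at_const diff_at_id atlas_Q)
  from diff_at_compose [OF atlas_Q differentiable_atlas_prod [OF atlas_Q atlas_Q] this L_diff_at [OF assms]]
  show ?thesis .
qed

lemma L_right_diff_at:
  assumes "q0 \<in> mcarrier Q" "q1 \<in> mcarrier Q"
  shows "diff_at Q vspace_manifold (\<lambda>q. L (q0, q)) q1"
proof -
  have "diff_at Q (prod_manifold Q Q) (\<lambda>q. (q0, q)) q1"
    using assms by (intro diff_at_Pair diff_at_const diff_at_id atlas_Q)
  from diff_at_compose [OF atlas_Q differentiable_atlas_prod [OF atlas_Q atlas_Q] this L_diff_at [OF assms]]
  show ?thesis .
qed

lemma D1_translate: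
  assumes g: "g \<in> carrier K" and q0: "q0 \<in> mcarrier Q" and q1: "q1 \<in> mcarrier Q"
  shows "D1 Q L (l g q0) (l g q1) (tmap Q Q (l g) q0 X) = D1 Q L q0 q1 X"
proof -
  have "tmap Q vspace_manifold (\<lambda>q. L (q, l g q1)) (l g q0) (tmap Q Q (l g) q0 X) =
      tmap Q vspace_manifold (\<lambda>q. L (l g q, l g q1)) q0 X"
    using L_left_diff_at [of "l g q0" "l g q1"] g q0 q1
    by (intro tmap_compose atlas_Q translation_diff_at) (simp_all add: act_closed)
  also have "\<dots> = tmap Q vspace_manifold (\<lambda>q. L (q, q1)) q0 X"
    using g q0 q1 by (intro tmap_cong atlas_Q near_mcarrier) (simp_all add: L_invariant)
  finally show ?thesis by (simp add: D1_def mdiff_eq_tmap)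
qed

text \<open>
  The momentum map is equivariant because the generators are and the Lagrangian is invariant.
\<close>

lemma momentum_map_translate:
  assumes g: "g \<in> carrier K" and q0: "q0 \<in> mcarrier Q" and q1: "q1 \<in> mcarrier Q"
    and \<xi>: "\<xi> \<in> lie_algebra K AK"
  shows "J (l g q0) (l g q1) \<xi> = J q0 q1 (Ad K AK (inv g) \<xi>)"
  using g \<xi> Ad_in_lie_algebra [of "inv g" \<xi>]
  by (simp add: momentum_map_def inf_gen_translate [OF g q0] D1_translate [OF g q0 q1])

lemma momentum_level_translate:
  assumes g: "g \<in> carrier K" and q0: "q0 \<in> mcarrier Q" and q1: "q1 \<in> mcarrier Q"
    and J: "J q0 q1 = \<nu>"
  shows "J (l g q0) (l g q1) = \<nu>"
proof (rule extensionalityI [OF _ level_extensional])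
  show "J (l g q0) (l g q1) \<in> extensional (lie_algebra K AK)" by (simp add: momentum_map_def)
  show "J (l g q0) (l g q1) \<xi> = \<nu> \<xi>" if "\<xi> \<in> lie_algebra K AK" for \<xi>
    using momentum_map_translate [OF g q0 q1 that] J level_Ad [of "inv g" \<xi>] g that by simp
qed

text \<open>
  By invariance \<open>w \<mapsto> L (w \<cdot> q\<^sub>0, w \<cdot> q\<^sub>1)\<close> is constant. Its derivative at the identity, the sum of the two
  partial differentials on the generators, therefore vanishes, so that differentiating in the second
  argument alone gives minus the first partial differential, which is the momentum.
\<close>

lemma momentum_map_eq_second_partial:
  assumes q0: "q0 \<in> mcarrier Q" and q1: "q1 \<in> mcarrier Q" and \<xi>: "\<xi> \<in> lie_algebra K AK"
  shows "mdiff AK (\<lambda>w. L (q0, l w q1)) \<one> \<xi> = J q0 q1 \<xi>"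
proof -
  let ?V = "vspace_manifold :: (real, real) atlas"
  note QQ = differentiable_atlas_prod [OF atlas_Q atlas_Q]
  note o0 = orbit_map_diff_at [OF one_closed q0] and o1 = orbit_map_diff_at [OF one_closed q1]
  have o: "diff_at AK (prod_manifold Q Q) (\<lambda>w. (l w q0, l w q1)) \<one>" by (rule diff_at_Pair [OF o0 o1])
  define Z where "Z = tmap AK (prod_manifold Q Q) (\<lambda>w. (l w q0, l w q1)) \<one> \<xi>"
  have Z: "Z \<in> tspace (prod_manifold Q Q) (q0, q1)"
    using tmap_in_tspace [OF atlas_K QQ o] by (simp add: Z_def act_one q0 q1)
  have Z0: "tmap (prod_manifold Q Q) Q fst (q0, q1) Z = inf_gen K AK Q l \<xi> q0"
    using tmap_compose [OF atlas_K QQ o, of Q fst \<xi>] diff_at_fst [OF atlas_Q atlas_Q q0 q1]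
    by (simp add: Z_def inf_gen_def act_one q0 q1)
  have Z1: "tmap (prod_manifold Q Q) Q snd (q0, q1) Z = inf_gen K AK Q l \<xi> q1"
    using tmap_compose [OF atlas_K QQ o, of Q snd \<xi>] diff_at_snd [OF atlas_Q atlas_Q q0 q1]
    by (simp add: Z_def inf_gen_def act_one q0 q1)
  have "tmap (prod_manifold Q Q) ?V L (q0, q1) Z = tmap AK ?V (\<lambda>w. L (l w q0, l w q1)) \<one> \<xi>"
    using tmap_compose [OF atlas_K QQ o, of ?V L \<xi>] L_diff_at [OF q0 q1] by (simp add: Z_def act_one q0 q1)
  also have "\<dots> = tmap AK ?V (\<lambda>w. L (q0, q1)) \<one> \<xi>"
    using q0 q1 by (intro tmap_cong atlas_K near_mcarrier) (simp_all add: mcarrier_K L_invariant)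
  finally have "tmap (prod_manifold Q Q) ?V L (q0, q1) Z = tzero" by (simp add: tmap_const)
  then have "tadd (tmap Q ?V (\<lambda>q. L (q, q1)) q0 (inf_gen K AK Q l \<xi> q0))
      (tmap Q ?V (\<lambda>q. L (q0, q)) q1 (inf_gen K AK Q l \<xi> q1)) = tzero"
    by (simp add: tmap_partials [OF atlas_Q atlas_Q L_diff_at [OF q0 q1] Z] Z0 Z1)
  from fun_cong [OF this, of "(UNIV, \<lambda>x. x)"]
  have "D1 Q L q0 q1 (inf_gen K AK Q l \<xi> q0) + mdiff Q (\<lambda>q. L (q0, q)) q1 (inf_gen K AK Q l \<xi> q1) = 0"
    by (simp add: tadd_def tzero_def D1_def mdiff_eq_tmap)
  moreover have "mdiff AK (\<lambda>w. L (q0, l w q1)) \<one> \<xi> = mdiff Q (\<lambda>q. L (q0, q)) q1 (inf_gen K AK Q l \<xi> q1)"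
    using tmap_compose [OF atlas_K atlas_Q o1, of ?V "\<lambda>q. L (q0, q)" \<xi>] L_right_diff_at [OF q0 q1]
    by (simp add: mdiff_eq_tmap inf_gen_def act_one q1)
  ultimately show ?thesis using \<xi> by (simp add: momentum_map_def)
qed

lemma discrete_connection_eqI:
  assumes "q0 \<in> mcarrier Q" "q1 \<in> mcarrier Q" "g \<in> carrier K" "J q0 (l (inv g) q1) = \<nu>"
  shows "\<A> (q0, q1) = g"
  unfolding discrete_connection_def prod.case
  using ex1_connection [OF assms(1,2)] assms(3,4) by (intro the1_equality) blast+

lemma discrete_connection:
  assumes "q0 \<in> mcarrier Q" "q1 \<in> mcarrier Q"
  shows "\<A> (q0, q1) \<in> carrier K" and "J q0 (l (inv (\<A> (q0, q1))) q1) = \<nu>"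
  using theI' [OF ex1_connection [OF assms]] unfolding discrete_connection_def prod.case by blast+

lemma discrete_connection_translate:
  assumes g: "g \<in> carrier K" and q0: "q0 \<in> mcarrier Q" and q1: "q1 \<in> mcarrier Q"
  shows "\<A> (l g q0, l g q1) = g \<otimes> \<A> (q0, q1) \<otimes> inv g"
proof (rule discrete_connection_eqI)
  let ?h = "\<A> (q0, q1)"
  note h = discrete_connection [OF q0 q1]
  show "l g q0 \<in> mcarrier Q" "l g q1 \<in> mcarrier Q" using act_closed g q0 q1 by blast+
  show "g \<otimes> ?h \<otimes> inv g \<in> carrier K" using g h(1) by simp
  have "inv (g \<otimes> ?h \<otimes> inv g) = g \<otimes> inv ?h \<otimes> inv g"
    using g h(1) by (simp add: inv_mult_group m_assoc)
  then have "l (inv (g \<otimes> ?h \<otimes> inv g)) (l g q1) = l g (l (inv ?h) q1)"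
    using g h(1) q1 by (simp add: act_mult act_inv act_closed)
  then show "J (l g q0) (l (inv (g \<otimes> ?h \<otimes> inv g)) (l g q1)) = \<nu>"
    using momentum_level_translate [OF g q0 _ h(2)] g h(1) q1 by (simp add: act_closed)
qed

text \<open>
  Points of one fibre at the same momentum level differ by a group element that the uniqueness of the
  discrete connection forces to be the identity.
\<close>

lemma discrete_lift_eqI:
  assumes q0: "q0 \<in> mcarrier Q" and q1: "q1 \<in> mcarrier Q" and J: "J q0 q1 = \<nu>"
  shows "lift q0 (orbit K l q1) = q1"
  unfolding discrete_lift_def
proof (rule the_equality)
  show "q1 \<in> mcarrier Q \<and> orbit K l q1 = orbit K l q1 \<and> J q0 q1 = \<nu>" using q1 J by blast
  fix q assume q: "q \<in> mcarrier Q \<and> orbit K l q = orbit K l q1 \<and> J q0 q = \<nu>"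
  then have "q \<in> orbit K l q1" using orbit_refl by blast
  then obtain h where h: "h \<in> carrier K" "q = l h q1" unfolding orbit_def by blast
  have "\<A> (q0, q1) = inv h" using discrete_connection_eqI [OF q0 q1, of "inv h"] h q by simp
  moreover have "\<A> (q0, q1) = \<one>" using discrete_connection_eqI [OF q0 q1, of \<one>] J by (simp add: act_one q1)
  ultimately have "h = \<one>" using h(1) by (metis inv_inv inv_one)
  then show "q = q1" using h(2) by (simp add: act_one q1)
qed

text \<open>
  The discrete lift is the given point of the fibre, translated by the inverse of its discrete
  connection value.
\<close>

lemma discrete_lift:
  assumes q0: "q0 \<in> mcarrier Q" and q: "q \<in> mcarrier Q"
  shows "lift q0 (orbit K l q) \<in> mcarrier Q" (is ?closed)
    and "orbit K l (lift q0 (orbit K l q)) = orbit K l q" (is ?fibre)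
    and "J q0 (lift q0 (orbit K l q)) = \<nu>" (is ?level)
proof -
  note h = discrete_connection [OF q0 q]
  have h': "inv (\<A> (q0, q)) \<in> carrier K" using h(1) by simp
  note q1 = act_closed [OF h' q] and orb = orbit_translate [OF h' q]
  have "lift q0 (orbit K l q) = l (inv (\<A> (q0, q))) q"
    using discrete_lift_eqI [OF q0 q1 h(2)] by (simp add: orb)
  then show ?closed ?fibre ?level using q1 orb h(2) by simp_all
qed

lemma discrete_connection_lift:
  assumes q0: "q0 \<in> mcarrier Q" and q: "q \<in> mcarrier Q"
  shows "\<A> (q0, lift q0 (orbit K l q)) = \<one>"
  using discrete_connection_eqI [OF q0 discrete_lift(1) [OF q0 q], of \<one>] discrete_lift [OF q0 q]
  by (simp add: act_one)

lemma discrete_lift_translate: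
  assumes g: "g \<in> carrier K" and q0: "q0 \<in> mcarrier Q" and q: "q \<in> mcarrier Q"
  shows "lift (l g q0) (orbit K l q) = l g (lift q0 (orbit K l q))"
proof -
  note q1 = discrete_lift [OF q0 q]
  show ?thesis
    using discrete_lift_eqI [OF act_closed [OF g q0] act_closed [OF g q1(1)] momentum_level_translate [OF g q0 q1(1,3)]]
    by (simp add: orbit_translate g q1)
qed

text \<open>
  The tangent form of \<open>discrete_connection_translate\<close>: differentiate
  \<open>\<A> (g \<cdot> q\<^sub>0, g \<cdot> q\<^sub>1) = g \<A> (q\<^sub>0, q\<^sub>1) g\<^sup>-\<^sup>1\<close>. At a pair where \<open>\<A>\<close> takes the value \<open>e\<close>, the derivative of
  the conjugation is the adjoint action.
\<close>

lemma tmap_discrete_connection_translate: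
  assumes \<A>: "\<And>q0 q1. q0 \<in> mcarrier Q \<Longrightarrow> q1 \<in> mcarrier Q \<Longrightarrow> diff_at (prod_manifold Q Q) AK \<A> (q0, q1)"
    and g: "g \<in> carrier K" and q0: "q0 \<in> mcarrier Q" and q1: "q1 \<in> mcarrier Q"
    and e: "\<A> (q0, q1) = \<one>"
    and X: "X \<in> tspace Q q0" and Y: "Y \<in> tspace Q q1"
  shows "tmap (prod_manifold Q Q) AK \<A> (l g q0, l g q1)
      (tpair Q Q (l g q0) (l g q1) (tmap Q Q (l g) q0 X) (tmap Q Q (l g) q1 Y)) =
    Ad K AK g (tmap (prod_manifold Q Q) AK \<A> (q0, q1) (tpair Q Q q0 q1 X Y))"
proof -
  note QQ = differentiable_atlas_prod [OF atlas_Q atlas_Q]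
  note fst_diff = diff_at_fst [OF atlas_Q atlas_Q q0 q1] and snd_diff = diff_at_snd [OF atlas_Q atlas_Q q0 q1]
  note Z = tpair [OF atlas_Q atlas_Q q0 q1 X Y]
  let ?Z = "tpair Q Q q0 q1 X Y"
  have d0: "diff_at (prod_manifold Q Q) Q (\<lambda>z. l g (fst z)) (q0, q1)"
    using diff_at_compose [OF QQ atlas_Q fst_diff] translation_diff_at [OF g q0] by simp
  have d1: "diff_at (prod_manifold Q Q) Q (\<lambda>z. l g (snd z)) (q0, q1)"
    using diff_at_compose [OF QQ atlas_Q snd_diff] translation_diff_at [OF g q1] by simp
  have t0: "tmap (prod_manifold Q Q) Q (\<lambda>z. l g (fst z)) (q0, q1) ?Z = tmap Q Q (l g) q0 X"
    using tmap_compose [OF QQ atlas_Q fst_diff, of Q "l g" ?Z] translation_diff_at [OF g q0] Z(2) by simp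
  have t1: "tmap (prod_manifold Q Q) Q (\<lambda>z. l g (snd z)) (q0, q1) ?Z = tmap Q Q (l g) q1 Y"
    using tmap_compose [OF QQ atlas_Q snd_diff, of Q "l g" ?Z] translation_diff_at [OF g q1] Z(3) by simp
  note d = diff_at_Pair [OF d0 d1]
  have "tpair Q Q (l g q0) (l g q1) (tmap Q Q (l g) q0 X) (tmap Q Q (l g) q1 Y) =
      tmap (prod_manifold Q Q) (prod_manifold Q Q) (\<lambda>z. (l g (fst z), l g (snd z))) (q0, q1) ?Z"
    using tmap_Pair [OF QQ atlas_Q atlas_Q d0 d1, of ?Z] by (simp add: t0 t1)
  then have "tmap (prod_manifold Q Q) AK \<A> (l g q0, l g q1)
      (tpair Q Q (l g q0) (l g q1) (tmap Q Q (l g) q0 X) (tmap Q Q (l g) q1 Y)) =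
      tmap (prod_manifold Q Q) AK (\<lambda>z. \<A> (l g (fst z), l g (snd z))) (q0, q1) ?Z"
    using tmap_compose [OF QQ QQ d, of AK \<A> ?Z] \<A> [OF act_closed [OF g q0] act_closed [OF g q1]] by simp
  also have "\<dots> = tmap (prod_manifold Q Q) AK (\<lambda>z. g \<otimes> \<A> z \<otimes> inv g) (q0, q1) ?Z"
  proof (rule tmap_cong [OF QQ _ near_mcarrier [OF QQ]])
    show "\<A> (l g (fst z), l g (snd z)) = g \<otimes> \<A> z \<otimes> inv g" if "z \<in> mcarrier (prod_manifold Q Q)" for z
      using that discrete_connection_translate [OF g, of "fst z" "snd z"] by (simp add: mem_Times_iff)
  qed (simp add: q0 q1)
  also have "\<dots> = tmap AK AK (\<lambda>w. g \<otimes> w \<otimes> inv g) (\<A> (q0, q1)) (tmap (prod_manifold Q Q) AK \<A> (q0, q1) ?Z)"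
    using conjugation_diff_at [OF g one_closed]
    by (intro tmap_compose [OF QQ atlas_K \<A> [OF q0 q1], symmetric]) (simp add: e)
  finally show ?thesis by (simp add: e Ad_def)
qed

end

section \<open>The isotropy subgroup of a momentum value\<close>

lemma lie_group_mult_diff_at:
  assumes "lie_group G AG" "g \<in> carrier G" "h \<in> carrier G"
  shows "diff_at (prod_manifold AG AG) AG (\<lambda>(g, h). g \<otimes>\<^bsub>G\<^esub> h) (g, h)"
proof -
  have s: "smooth_map (prod_manifold AG AG) AG (\<lambda>(g, h). g \<otimes>\<^bsub>G\<^esub> h)"
    and A: "differentiable_atlas AG" and c: "mcarrier AG = carrier G"
    using assms(1) smooth_manifold_differentiable_atlas unfolding lie_group_def by blast+
  show ?thesis
    using assms(2,3) by (intro smooth_map_diff_at [OF differentiable_atlas_prod [OF A A] A s]) (simp add: c)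
qed

lemma differentiable_action_lie_group:
  assumes Q: "smooth_manifold Q" and G: "lie_group G AG" and l: "left_action G AG Q l"
  shows "differentiable_action G AG Q l"
proof -
  have group: "group G" and A: "differentiable_atlas AG" and c: "mcarrier AG = carrier G"
    using G smooth_manifold_differentiable_atlas unfolding lie_group_def by blast+
  note atlas_Q = smooth_manifold_differentiable_atlas [OF Q]
  have s: "smooth_map (prod_manifold AG Q) Q (\<lambda>(g, q). l g q)"
    using l unfolding left_action_def by blast
  show ?thesis
  proof (intro differentiable_action.intro differentiable_action_axioms.intro)
    show "diff_at (prod_manifold AG Q) Q (\<lambda>(g, q). l g q) (g, q)"
      if "g \<in> carrier G" "q \<in> mcarrier Q" for g q
      using that by (intro smooth_map_diff_at [OF differentiable_atlas_prod [OF A atlas_Q] atlas_Q s]) (simp add: c)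
  qed (use group A c atlas_Q lie_group_mult_diff_at [OF G] l in \<open>auto simp: left_action_def\<close>)
qed

lemma differentiable_action_subgroup:
  assumes G: "differentiable_action G AG Q l" and H: "subgroup H G"
    and K: "lie_group (G\<lparr>carrier := H\<rparr>) AK" and sub: "embedded_submanifold AK AG"
  shows "differentiable_action (G\<lparr>carrier := H\<rparr>) AK Q l"
proof -
  interpret G: differentiable_action G AG Q l by (rule G)
  let ?K = "G\<lparr>carrier := H\<rparr>"
  have group: "group ?K" and A: "differentiable_atlas AK" and c: "mcarrier AK = H"
    using K smooth_manifold_differentiable_atlas unfolding lie_group_def by auto
  note H_G = subgroup.mem_carrier [OF H]
  note AQ = differentiable_atlas_prod [OF A G.atlas_Q] and GQ = differentiable_atlas_prod [OF G.atlas_K G.atlas_Q]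
  have incl: "diff_at AK AG (\<lambda>g. g) g" if "g \<in> H" for g
    using smooth_map_diff_at [OF A G.atlas_K] sub that unfolding embedded_submanifold_def by (simp add: c)
  show ?thesis
  proof (intro differentiable_action.intro differentiable_action_axioms.intro)
    show "diff_at (prod_manifold AK Q) Q (\<lambda>(g, q). l g q) (g, q)"
      if "g \<in> carrier ?K" and q: "q \<in> mcarrier Q" for g q
    proof -
      have g: "g \<in> H" using that(1) by simp
      have gK: "g \<in> mcarrier AK" using g by (simp add: c)
      have "diff_at (prod_manifold AK Q) AG (\<lambda>z. fst z) (g, q)"
        using diff_at_compose [OF AQ A diff_at_fst [OF A G.atlas_Q gK q]] incl [OF g] by simp
      from diff_at_Pair [OF this diff_at_snd [OF A G.atlas_Q gK q]]
      have *: "diff_at (prod_manifold AK Q) (prod_manifold AG Q) (\<lambda>z. (fst z, snd z)) (g, q)" .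
      show ?thesis
        using diff_at_compose [OF AQ GQ *, of Q "\<lambda>(g, q). l g q"] G.act_diff_at [OF H_G [OF g] q]
        by (simp add: case_prod_unfold)
    qed
    show "l (g \<otimes>\<^bsub>?K\<^esub> h) q = l g (l h q)"
      if "g \<in> carrier ?K" "h \<in> carrier ?K" "q \<in> mcarrier Q" for g h q
      using that G.act_mult H_G by simp
    show "diff_at (prod_manifold AK AK) AK (\<lambda>(g, h). g \<otimes>\<^bsub>?K\<^esub> h) (g, h)"
      if "g \<in> carrier ?K" "h \<in> carrier ?K" for g h
      using lie_group_mult_diff_at [OF K that] .
  qed (use group A c G.atlas_Q G.act_one in simp_all)
qed

text \<open>
  The inclusion intertwines the conjugations by \<open>g\<close> in the subgroup and in the group, hence the two
  adjoint actions, and \<open>\<mu>\<close> is fixed by \<open>g\<close> as a functional on the larger Lie algebra.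
\<close>

lemma restrict_dual_Ad_invariant:
  assumes G: "differentiable_action G AG Q l" and H: "subgroup H G" and H_def: "H = coadjoint_isotropy G AG \<mu>"
    and K: "lie_group (G\<lparr>carrier := H\<rparr>) AK" and sub: "embedded_submanifold AK AG"
    and g: "g \<in> H" and \<xi>: "\<xi> \<in> tspace AK \<one>\<^bsub>G\<^esub>"
  shows "restrict_dual G AG AK \<mu> (Ad (G\<lparr>carrier := H\<rparr>) AK g \<xi>) = restrict_dual G AG AK \<mu> \<xi>"
proof -
  interpret G: differentiable_action G AG Q l by (rule G)
  interpret K: differentiable_action "G\<lparr>carrier := H\<rparr>" AK Q l
    by (rule differentiable_action_subgroup [OF G H K sub])
  have incl: "diff_at AK AG (\<lambda>g. g) \<one>\<^bsub>G\<^esub>"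
    using smooth_map_diff_at [OF K.atlas_K G.atlas_K] sub K.one_closed
    unfolding embedded_submanifold_def by (simp add: K.mcarrier_K)
  have gG: "g \<in> carrier G" and inv: "inv\<^bsub>G\<lparr>carrier := H\<rparr>\<^esub> g = inv\<^bsub>G\<^esub> g"
    using subgroup.mem_carrier [OF H g] G.m_inv_consistent [OF H g] by simp_all
  let ?conj = "\<lambda>h. g \<otimes>\<^bsub>G\<^esub> h \<otimes>\<^bsub>G\<^esub> inv\<^bsub>G\<^esub> g"
  have conjK: "diff_at AK AK ?conj \<one>\<^bsub>G\<^esub>"
    using K.conjugation_diff_at [of g "\<one>\<^bsub>G\<^esub>"] g K.one_closed by (simp add: inv)
  have conjG: "diff_at AG AG ?conj \<one>\<^bsub>G\<^esub>" by (rule G.conjugation_diff_at [OF gG G.one_closed])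
  have conj1: "?conj \<one>\<^bsub>G\<^esub> = \<one>\<^bsub>G\<^esub>" using gG by simp
  define \<eta> where "\<eta> = tmap AK AG (\<lambda>g. g) \<one>\<^bsub>G\<^esub> \<xi>"
  have \<eta>: "\<eta> \<in> lie_algebra G AG" unfolding \<eta>_def by (rule tmap_in_tspace [OF K.atlas_K G.atlas_K incl])
  have AdK: "Ad (G\<lparr>carrier := H\<rparr>) AK g \<xi> = tmap AK AK ?conj \<one>\<^bsub>G\<^esub> \<xi>"
    by (simp add: Ad_def inv)
  have "tmap AK AG (\<lambda>g. g) \<one>\<^bsub>G\<^esub> (tmap AK AK ?conj \<one>\<^bsub>G\<^esub> \<xi>) = tmap AK AG ?conj \<one>\<^bsub>G\<^esub> \<xi>"
    using tmap_compose [OF K.atlas_K K.atlas_K conjK, of AG "\<lambda>g. g" \<xi>] incl by (simp add: conj1)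
  also have "\<dots> = tmap AG AG ?conj \<one>\<^bsub>G\<^esub> \<eta>"
    unfolding \<eta>_def by (rule tmap_compose [OF K.atlas_K G.atlas_K incl conjG, symmetric])
  finally have "tmap AK AG (\<lambda>g. g) \<one>\<^bsub>G\<^esub> (Ad (G\<lparr>carrier := H\<rparr>) AK g \<xi>) = Ad G AG g \<eta>"
    unfolding AdK by (simp add: Ad_def)
  moreover have "Ad (G\<lparr>carrier := H\<rparr>) AK g \<xi> \<in> tspace AK \<one>\<^bsub>G\<^esub>"
    using K.Ad_in_lie_algebra [of g \<xi>] g by simp
  moreover have "\<mu> (Ad G AG g \<eta>) = \<mu> \<eta>"
  proof -
    \<comment> \<open>The definition of the isotropy group evaluates the adjoint action at the inverse.\<close>
    have "inv\<^bsub>G\<^esub> g \<in> H" by (rule subgroup.m_inv_closed [OF H g])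
    then have "Ad_star G AG (inv\<^bsub>G\<^esub> (inv\<^bsub>G\<^esub> g)) \<mu> = \<mu>" by (simp add: H_def coadjoint_isotropy_def)
    then have "Ad_star G AG g \<mu> \<eta> = \<mu> \<eta>" using gG by simp
    then show ?thesis using \<eta> by (simp add: Ad_star_def)
  qed
  ultimately show ?thesis using \<xi> by (simp add: restrict_dual_def \<eta>_def)
qed

section \<open>The force of the reduced system\<close>

theorem lemma3p18:
  fixes Q :: "('q, 'm::real_normed_vector) atlas"
    and L :: "'q \<times> 'q \<Rightarrow> real"
    and G K :: "'g monoid"
    and AG :: "('g, 'k::real_normed_vector) atlas"
    and AK :: "('g, 'h::real_normed_vector) atlas"
    and l :: "'g \<Rightarrow> 'q \<Rightarrow> 'q"
    and \<mu> :: "('g, 'k) tvec \<Rightarrow> real"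
    and \<nu> :: "('g, 'h) tvec \<Rightarrow> real"
    and B :: "('q set, 'b::real_normed_vector) atlas"
    and \<AA> :: "'q \<Rightarrow> ('q, 'm) tvec \<Rightarrow> ('g, 'h) tvec"
  assumes Q: "smooth_manifold Q"
    and G: "lie_group G AG"
    and action: "left_action G AG Q l" "free_action G Q l" "proper_action AG Q l"
    and L: "smooth_map (prod_manifold Q Q) vspace_manifold L" "regular_lagrangian Q L"
      "invariant_lagrangian G Q l L"
    and \<mu>: "\<mu> \<in> ctspace AG \<one>\<^bsub>G\<^esub>"
    and K: "K = G\<lparr>carrier := coadjoint_isotropy G AG \<mu>\<rparr>"
      "lie_group K AK" "embedded_submanifold AK AG"
    and \<nu>: "\<nu> = restrict_dual G AG AK \<mu>"
    and B: "quotient_principal_bundle K AK Q l B"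
    and good: "good_symmetries K AK Q l L \<nu>"
    and ex_conn: "\<And>q0 q1. q0 \<in> mcarrier Q \<Longrightarrow> q1 \<in> mcarrier Q \<Longrightarrow>
      \<exists>!g. g \<in> carrier K \<and> momentum_map K AK Q l L q0 (l (inv\<^bsub>K\<^esub> g) q1) = \<nu>"
    and smooth_conn: "smooth_map (prod_manifold Q Q) AK (discrete_connection K AK Q l L \<nu>)"
    and \<AA>: "principal_connection K AK Q l \<AA>"
    and \<tau>: "\<tau>0 \<in> mcarrier B" "\<tau>1 \<in> mcarrier B"
    and \<delta>\<tau>: "\<delta>\<tau>0 \<in> tspace B \<tau>0" "\<delta>\<tau>1 \<in> tspace B \<tau>1"
    and q0: "q0 \<in> mcarrier Q" "orbit K l q0 = \<tau>0"
    and q1: "q1 = discrete_lift K AK Q l L \<nu> q0 \<tau>1"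
  shows "f_breve K AK Q l L \<nu> B \<AA> (\<tau>0, \<tau>1) (\<delta>\<tau>0, \<delta>\<tau>1) =
    \<nu> (tmap (prod_manifold Q Q) AK (discrete_connection K AK Q l L \<nu>) (q0, q1)
        (tpair Q Q q0 q1
          (horizontal_lift K Q l B \<AA> q0 \<delta>\<tau>0) (horizontal_lift K Q l B \<AA> q1 \<delta>\<tau>1)))"
proof -
  define H where "H = coadjoint_isotropy G AG \<mu>"
  have K_H: "K = G\<lparr>carrier := H\<rparr>" using K(1) by (simp add: H_def)
  note actG = differentiable_action_lie_group [OF Q G action(1)]
  interpret G: differentiable_action G AG Q l by (rule actG)
  have "group K" using K(2) by (simp add: lie_group_def)
  then have H: "subgroup H G"
    unfolding K_H by (intro G.group_incl_imp_subgroup) (auto simp: H_def coadjoint_isotropy_def)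
  note lieK = K(2) [unfolded K_H]
  have one_K: "\<one>\<^bsub>K\<^esub> = \<one>\<^bsub>G\<^esub>" by (simp add: K_H)
  have actK: "differentiable_action K AK Q l"
    unfolding K_H by (rule differentiable_action_subgroup [OF actG H lieK K(3)])
  interpret P: principal_bundle K AK Q l B \<AA>
    by (intro principal_bundle.intro principal_bundle_axioms.intro actK B \<AA>)
  interpret M: invariant_lagrangian_level K AK Q l L \<nu>
  proof (intro invariant_lagrangian_level.intro invariant_lagrangian_level_axioms.intro actK)
    show "diff_at (prod_manifold Q Q) vspace_manifold L (q0, q1)"
      if "q0 \<in> mcarrier Q" "q1 \<in> mcarrier Q" for q0 q1
      using that by (intro smooth_map_diff_at [OF differentiable_atlas_prod [OF G.atlas_Q G.atlas_Q]
            differentiable_atlas_vspace L(1)]) simp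
    show "L (l g q0, l g q1) = L (q0, q1)"
      if "g \<in> carrier K" "q0 \<in> mcarrier Q" "q1 \<in> mcarrier Q" for g q0 q1
      using that L(3) subgroup.mem_carrier [OF H] by (simp add: invariant_lagrangian_def K_H)
    show "\<nu> \<in> extensional (lie_algebra K AK)" by (simp add: \<nu> restrict_dual_def one_K)
    show "\<nu> (Ad K AK g \<xi>) = \<nu> \<xi>" if "g \<in> carrier K" "\<xi> \<in> lie_algebra K AK" for g \<xi>
      using restrict_dual_Ad_invariant [OF actG H H_def lieK K(3), of g \<xi>] that by (simp add: \<nu> K_H)
  qed (rule ex_conn)
  have \<A>: "diff_at (prod_manifold Q Q) AK M.\<A> (x, y)" if "x \<in> mcarrier Q" "y \<in> mcarrier Q" for x y
    using that by (intro smooth_map_diff_at [OF differentiable_atlas_prod [OF G.atlas_Q G.atlas_Q] P.atlas_K smooth_conn]) simp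
  obtain q where q: "q \<in> mcarrier Q" "\<tau>1 = orbit K l q" using \<tau>(2) P.mcarrier_B by blast
  have q1_Q: "q1 \<in> mcarrier Q" and q1_orbit: "orbit K l q1 = \<tau>1" and conn_one: "M.\<A> (q0, q1) = \<one>\<^bsub>K\<^esub>"
    using M.discrete_lift [OF q0(1) q(1)] M.discrete_connection_lift [OF q0(1) q(1)] by (simp_all add: q1 q(2))
  have \<delta>0: "\<delta>\<tau>0 \<in> tspace B (orbit K l q0)" and \<delta>1: "\<delta>\<tau>1 \<in> tspace B (orbit K l q1)"
    using \<delta>\<tau> by (simp_all add: q0(2) q1_orbit)
  \<comment> \<open>The point over \<open>\<tau>0\<close> that the definition of the force chooses; everything attached to it is the
    translate by some \<open>g\<close> of what belongs to \<open>q0\<close>.\<close>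
  define q0' where "q0' = (SOME q. q \<in> mcarrier Q \<and> orbit K l q = \<tau>0)"
  have "q0' \<in> mcarrier Q \<and> orbit K l q0' = \<tau>0"
    unfolding q0'_def by (rule someI [of _ q0]) (simp add: q0)
  then have "q0' \<in> orbit K l q0" using P.orbit_refl [of q0'] q0(2) by simp
  then obtain g where g: "g \<in> carrier K" and q0': "q0' = l g q0" unfolding orbit_def by blast
  have lift': "M.lift q0' \<tau>1 = l g q1"
    using M.discrete_lift_translate [OF g q0(1) q(1)] by (simp add: q0' q(2) q1)
  define Z where "Z = tmap (prod_manifold Q Q) AK M.\<A> (q0, q1)
    (tpair Q Q q0 q1 (horizontal_lift K Q l B \<AA> q0 \<delta>\<tau>0) (horizontal_lift K Q l B \<AA> q1 \<delta>\<tau>1))"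
  have Z: "Z \<in> lie_algebra K AK"
    unfolding Z_def conn_one [symmetric]
    by (rule tmap_in_tspace [OF differentiable_atlas_prod [OF G.atlas_Q G.atlas_Q] P.atlas_K \<A> [OF q0(1) q1_Q]])
  have Z': "tmap (prod_manifold Q Q) AK M.\<A> (l g q0, l g q1)
      (tpair Q Q (l g q0) (l g q1)
        (horizontal_lift K Q l B \<AA> (l g q0) \<delta>\<tau>0) (horizontal_lift K Q l B \<AA> (l g q1) \<delta>\<tau>1)) = Ad K AK g Z"
    unfolding Z_def P.horizontal_lift_translate [OF q0(1) \<delta>0 g] P.horizontal_lift_translate [OF q1_Q \<delta>1 g]
    by (rule M.tmap_discrete_connection_translate [OF \<A> g q0(1) q1_Q conn_one
          P.horizontal_lift(1) [OF q0(1) \<delta>0] P.horizontal_lift(1) [OF q1_Q \<delta>1]])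
  have level: "M.J (l g q0) (l g q1) = \<nu>"
    using M.momentum_level_translate [OF g q0(1) q1_Q] M.discrete_lift(3) [OF q0(1) q(1)] by (simp add: q1 q(2))
  have "f_breve K AK Q l L \<nu> B \<AA> (\<tau>0, \<tau>1) (\<delta>\<tau>0, \<delta>\<tau>1) =
      mdiff AK (\<lambda>w. L (l g q0, l w (l g q1))) \<one>\<^bsub>K\<^esub> (Ad K AK g Z)"
    by (simp add: f_breve_def Let_def L_check_def q0'_def [symmetric] lift' Z' [symmetric])
      (simp add: q0' lift' [unfolded q0'])
  also have "\<dots> = M.J (l g q0) (l g q1) (Ad K AK g Z)"
    by (rule M.momentum_map_eq_second_partial
        [OF P.act_closed [OF g q0(1)] P.act_closed [OF g q1_Q] P.Ad_in_lie_algebra [OF g]])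
  also have "\<dots> = \<nu> Z" unfolding level by (rule M.level_Ad [OF g Z])
  finally show ?thesis unfolding Z_def .
qed

end
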